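(* Let $n,d\ge 1$ be integers, $\lambda>0$, $\mathbf{x}_1,\dots,\mathbf{x}_n\in\mathbb{R}^d$, $y_1,\dots,y_n\in\{-1,+1\}$, and $\mathcal{I}_+\subseteq\{1,\dots,d\}$. Suppose $\|\mathbf{x}_i\|\le R$ for all $i\in\{1,\dots,n\}$. Consider the Frank-Wolfe algorithm applied to the dual problem of maximizing $D(\boldsymbol{\alpha})$ over $\boldsymbol{\alpha}\in[0,1]^n$: starting from any $\boldsymbol{\alpha}^{(0)}\in[0,1]^n$, for $t=1,2,\dots$, $$\mathbf{u}_t\in\operatorname*{argmax}_{\mathbf{u}\in[0,1]^n}\langle\nabla D(\boldsymbol{\alpha}^{(t-1)}),\mathbf{u}\rangle,\quad \mathbf{q}_t:=\mathbf{u}_t-\boldsymbol{\alpha}^{(t-1)},\quad \eta_t\in\operatorname*{argmax}_{\eta\in[0,1]}D(\boldsymbol{\alpha}^{(t-1)}+\eta\mathbf{q}_t),\quad \boldsymbol{\alpha}^{(t)}:=\boldsymbol{\alpha}^{(t-1)}+\eta_t\mathbf{q}_t.$$ Then: (1) when $d=O(n)$, each iteration (computing exact solutions $\mathbf{u}_t$ and $\eta_t$ of the two subproblems and the update $\boldsymbol{\alpha}^{(t)}$ from $\boldsymbol{\alpha}^{(t-1)}$) can be performed within $O(nd)$ computational cost; (2) for every $\epsilon>0$ and every positive integer $T$ with $$T\ge\frac{2R^2}{\lambda\epsilon}-2,$$ one has $D(\boldsymbol{\alpha}_\star)-D(\boldsymbol{\alpha}^{(T)})\le\epsilon$, where $\boldsymbol{\alpha}_\star$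 is a maximizer of $D$ over $[0,1]^n$.
   Context: Norms are Euclidean. Let $\mathbf{X}\in\mathbb{R}^{d\times n}$ be the matrix whose $i$-th column is $y_i\mathbf{x}_i$. Let $\mathcal{S}:=\{\mathbf{w}\in\mathbb{R}^d : w_h\ge 0\text{ for all }h\in\mathcal{I}_+\}$ and let $\Pi_{\mathcal{S}}$ be the Euclidean projection onto $\mathcal{S}$ (it replaces $v_h$ by $\max(0,v_h)$ for $h\in\mathcal{I}_+$ and leaves the other coordinates unchanged). Define $$\mathbf{w}(\boldsymbol{\alpha}):=\Pi_{\mathcal{S}}\left(\frac{1}{\lambda n}\mathbf{X}\boldsymbol{\alpha}\right),\qquad D(\boldsymbol{\alpha}):=-\frac{\lambda}{2}\|\mathbf{w}(\boldsymbol{\alpha})\|^2+\frac1n\langle\mathbf{1},\boldsymbol{\alpha}\rangle,$$ with $\mathbf{1}$ the all-ones vector. (This $D$ is the dual objective of minimizing $\frac{\lambda}{2}\|\mathbf{w}\|^2+\frac1n\sum_i\max(0,1-y_i\langle\mathbf{x}_i,\mathbf{w}\rangle)$ over $\mathbf{w}\in\mathcal{S}$.) Computational cost is the number of elementary real operations (additions, multiplications, divisions, comparisons), with a constant in $O(nd)$ that does not depend on the data, $\lambda$ or $t$ (it may depend on the constant in $d=O(n)$). *)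

theory Defs
  imports "HOL-Analysis.Derivative" "Jordan_Normal_Form.Matrix"
begin

unbundle no vec_syntax
no_notation inner (infix \<open>\<bullet>\<close> 70)

section \<open>The dual problem and the Frank-Wolfe iteration\<close>

text \<open>Indices start at 0: coordinates range over \<open>{..<d}\<close> and examples over \<open>{..<n}\<close>.\<close>

definition vnorm :: "real vec \<Rightarrow> real" where
  "vnorm v = sqrt (v \<bullet> v)"

definition orthant :: "nat \<Rightarrow> nat set \<Rightarrow> real vec set" where
  "orthant d I = {w \<in> carrier_vec d. \<forall>h\<in>I. 0 \<le> w $ h}"

text \<open>Euclidean projection: the unique nearest point of \<open>S\<close>.\<close>

definition eproj :: "real vec set \<Rightarrow> real vec \<Rightarrow> real vec" where
  "eproj S v = (THE w. w \<in> S \<and> (\<forall>w'\<in>S. vnorm (v - w) \<le> vnorm (v - w')))"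

definition data_mat :: "nat \<Rightarrow> nat \<Rightarrow> (nat \<Rightarrow> real vec) \<Rightarrow> (nat \<Rightarrow> real) \<Rightarrow> real mat" where
  "data_mat n d x y = mat d n (\<lambda>(h, i). y i * x i $ h)"

definition primal_of ::
  "nat \<Rightarrow> nat \<Rightarrow> real \<Rightarrow> (nat \<Rightarrow> real vec) \<Rightarrow> (nat \<Rightarrow> real) \<Rightarrow> nat set \<Rightarrow> real vec \<Rightarrow> real vec" where
  "primal_of n d lam x y I \<alpha> =
     eproj (orthant d I) ((1 / (lam * real n)) \<cdot>\<^sub>v (data_mat n d x y *\<^sub>v \<alpha>))"

definition svm_dual ::
  "nat \<Rightarrow> nat \<Rightarrow> real \<Rightarrow> (nat \<Rightarrow> real vec) \<Rightarrow> (nat \<Rightarrow> real) \<Rightarrow> nat set \<Rightarrow> real vec \<Rightarrow> real" where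
  "svm_dual n d lam x y I \<alpha> =
     - (lam / 2) * (vnorm (primal_of n d lam x y I \<alpha>))\<^sup>2 + (1 / real n) * (vec n (\<lambda>_. 1) \<bullet> \<alpha>)"

text \<open>The vector of partial derivatives of a function on \<open>carrier_vec n\<close>.\<close>

definition grad :: "nat \<Rightarrow> (real vec \<Rightarrow> real) \<Rightarrow> real vec \<Rightarrow> real vec" where
  "grad n f \<alpha> = vec n (\<lambda>i. deriv (\<lambda>s. f (\<alpha> + s \<cdot>\<^sub>v unit_vec n i)) 0)"

definition box01 :: "nat \<Rightarrow> real vec set" where
  "box01 n = {\<alpha> \<in> carrier_vec n. \<forall>i<n. \<alpha> $ i \<in> {0..1}}"

definition valid_instance ::
  "nat \<Rightarrow> nat \<Rightarrow> real \<Rightarrow> (nat \<Rightarrow> real vec) \<Rightarrow> (nat \<Rightarrow> real) \<Rightarrow> nat set \<Rightarrow> bool" where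
  "valid_instance n d lam x y I \<longleftrightarrow>
     1 \<le> n \<and> 1 \<le> d \<and> 0 < lam \<and> (\<forall>i<n. x i \<in> carrier_vec d) \<and> (\<forall>i<n. y i \<in> {-1, 1}) \<and> I \<subseteq> {..<d}"

text \<open>One iteration, from \<open>\<alpha>\<close> to \<open>\<alpha>'\<close>. It is a relation, because neither of the two
  maximizers needs to be unique.\<close>

definition fw_step ::
  "nat \<Rightarrow> nat \<Rightarrow> real \<Rightarrow> (nat \<Rightarrow> real vec) \<Rightarrow> (nat \<Rightarrow> real) \<Rightarrow> nat set \<Rightarrow>
     real vec \<Rightarrow> real vec \<Rightarrow> real \<Rightarrow> real vec \<Rightarrow> bool" where
  "fw_step n d lam x y I \<alpha> u \<eta> \<alpha>' \<longleftrightarrow>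
     is_arg_max (\<lambda>v. grad n (svm_dual n d lam x y I) \<alpha> \<bullet> v) (\<lambda>v. v \<in> box01 n) u \<and>
     is_arg_max (\<lambda>e. svm_dual n d lam x y I (\<alpha> + e \<cdot>\<^sub>v (u - \<alpha>))) (\<lambda>e. e \<in> {0..1}) \<eta> \<and>
     \<alpha>' = \<alpha> + \<eta> \<cdot>\<^sub>v (u - \<alpha>)"

definition fw_run ::
  "nat \<Rightarrow> nat \<Rightarrow> real \<Rightarrow> (nat \<Rightarrow> real vec) \<Rightarrow> (nat \<Rightarrow> real) \<Rightarrow> nat set \<Rightarrow>
     (nat \<Rightarrow> real vec) \<Rightarrow> (nat \<Rightarrow> real vec) \<Rightarrow> (nat \<Rightarrow> real) \<Rightarrow> bool" where
  "fw_run n d lam x y I \<alpha> u \<eta> \<longleftrightarrow>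
     \<alpha> 0 \<in> box01 n \<and> (\<forall>t\<ge>1. fw_step n d lam x y I (\<alpha> (t - 1)) (u t) (\<eta> t) (\<alpha> t))"

subsection \<open>The projection in coordinates\<close>

lemma vnorm_sq: "(vnorm v)\<^sup>2 = (\<Sum>h<dim_vec v. (v $ h)\<^sup>2)"
  by (simp add: vnorm_def scalar_prod_def power2_eq_square sum_nonneg lessThan_atLeast0)

lemma vnorm_nonneg: "0 \<le> vnorm v"
  by (simp add: vnorm_def scalar_prod_def sum_nonneg)

lemma eproj_orthant:
  assumes v: "v \<in> carrier_vec d" and I: "I \<subseteq> {..<d}"
  shows "eproj (orthant d I) v = vec d (\<lambda>h. if h \<in> I then max 0 (v $ h) else v $ h)"
proof -
  define p where "p = vec d (\<lambda>h. if h \<in> I then max 0 (v $ h) else v $ h)"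
  have p: "p \<in> orthant d I" using I by (auto simp: p_def orthant_def)
  have pyth: "(vnorm (v - p))\<^sup>2 + (vnorm (p - w))\<^sup>2 \<le> (vnorm (v - w))\<^sup>2" if w: "w \<in> orthant d I" for w
  proof -
    have [simp]: "dim_vec w = d" "dim_vec v = d" "dim_vec p = d"
      using w v by (auto simp: orthant_def p_def)
    have "(v $ h - p $ h)\<^sup>2 + (p $ h - w $ h)\<^sup>2 \<le> (v $ h - w $ h)\<^sup>2" if h: "h < d" for h
    proof (cases "h \<in> I \<and> v $ h < 0")
      case True
      then have "p $ h = 0" "0 \<le> w $ h" using w h by (auto simp: p_def orthant_def)
      moreover have "v $ h * w $ h \<le> 0"
        using True \<open>0 \<le> w $ h\<close> by (simp add: mult_nonpos_nonneg)
      moreover have "(v $ h - w $ h)\<^sup>2 = (v $ h)\<^sup>2 + (w $ h)\<^sup>2 - 2 * (v $ h * w $ h)"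
        by (simp add: power2_diff)
      ultimately show ?thesis by simp
    next
      case False
      then have "p $ h = v $ h" using h by (auto simp: p_def)
      then show ?thesis by simp
    qed
    then have "(\<Sum>h<d. (v $ h - p $ h)\<^sup>2 + (p $ h - w $ h)\<^sup>2) \<le> (\<Sum>h<d. (v $ h - w $ h)\<^sup>2)"
      by (intro sum_mono) auto
    then show ?thesis by (simp add: vnorm_sq sum.distrib)
  qed
  have near: "vnorm (v - p) \<le> vnorm (v - w)" if "w \<in> orthant d I" for w
  proof (rule power2_le_imp_le)
    show "(vnorm (v - p))\<^sup>2 \<le> (vnorm (v - w))\<^sup>2"
      using pyth[OF that] zero_le_power2[of "vnorm (p - w)"] by linarith
  qed (rule vnorm_nonneg)
  have uniq: "w = p" if w: "w \<in> orthant d I" and le: "\<forall>w'\<in>orthant d I. vnorm (v - w) \<le> vnorm (v - w')" for w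
  proof -
    have "(vnorm (v - w))\<^sup>2 \<le> (vnorm (v - p))\<^sup>2"
      using le p vnorm_nonneg by (intro power_mono) auto
    then have "(vnorm (p - w))\<^sup>2 = 0"
      using pyth[OF w] zero_le_power2[of "vnorm (p - w)"] by linarith
    moreover have dim: "dim_vec w = d" "dim_vec p = d" using w by (auto simp: orthant_def p_def)
    ultimately have "\<forall>h<d. p $ h - w $ h = 0"
      by (simp add: vnorm_sq sum_nonneg_eq_0_iff)
    with dim show ?thesis by (intro eq_vecI) simp_all
  qed
  have "eproj (orthant d I) v = p"
    unfolding eproj_def
  proof (rule the_equality)
    show "p \<in> orthant d I \<and> (\<forall>w'\<in>orthant d I. vnorm (v - p) \<le> vnorm (v - w'))"
      using p near by blast
  qed (elim conjE, rule uniq)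
  then show ?thesis by (simp add: p_def)
qed

section \<open>Programs over the reals\<close>

text \<open>
  A real-number machine restricted to counted loops. Real arrays have two indices (scalars are
  stored at position \<open>(0, 0)\<close>), and an index is a numeral or an integer variable, so a real number
  influences the computation only through \<open>Arith\<close> and \<open>IfLe\<close>. Exactly these two instructions
  are charged, one unit each; integer literals, copying and loop control are free.
  Division by zero is a failure (\<open>None\<close>) and not the totalized division of HOL.
\<close>

datatype iexp = Num nat | Var string

datatype loc = Loc string iexp iexp

datatype aop = Add | Sub | Mul | Div

datatype prog =
    Skip
  | Lit loc int
  | Copy loc loc
  | Arith aop loc loc loc
  | Seq prog prog
  | IfLe loc loc prog prog
  | For string iexp prog

record state =
  idx :: "string \<Rightarrow> nat"
  mem :: "string \<Rightarrow> nat \<Rightarrow> nat \<Rightarrow> real"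
  ops :: nat

primrec ival :: "iexp \<Rightarrow> state \<Rightarrow> nat" where
  "ival (Num k) s = k"
| "ival (Var v) s = idx s v"

primrec get :: "loc \<Rightarrow> state \<Rightarrow> real" where
  "get (Loc a i j) s = mem s a (ival i s) (ival j s)"

primrec put :: "loc \<Rightarrow> real \<Rightarrow> state \<Rightarrow> state" where
  "put (Loc a i j) r s =
     s\<lparr>mem := (mem s)(a := (mem s a)(ival i s := (mem s a (ival i s))(ival j s := r)))\<rparr>"

definition set_idx :: "string \<Rightarrow> nat \<Rightarrow> state \<Rightarrow> state" where
  "set_idx v k s = s\<lparr>idx := (idx s)(v := k)\<rparr>"

definition tick :: "state \<Rightarrow> state" where
  "tick s = s\<lparr>ops := ops s + 1\<rparr>"

fun apply_op :: "aop \<Rightarrow> real \<Rightarrow> real \<Rightarrow> real option" where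
  "apply_op Add a b = Some (a + b)"
| "apply_op Sub a b = Some (a - b)"
| "apply_op Mul a b = Some (a * b)"
| "apply_op Div a b = (if b = 0 then None else Some (a / b))"

text \<open>\<open>Arith f l a b\<close> is \<open>l := a f b\<close>; \<open>For v m c\<close> runs \<open>c\<close> with \<open>v = 0, \<dots>, m - 1\<close>,
  where \<open>m\<close> is evaluated once, on entry.\<close>

primrec run :: "prog \<Rightarrow> state \<Rightarrow> state option" where
  "run Skip s = Some s"
| "run (Lit l k) s = Some (put l (of_int k) s)"
| "run (Copy l a) s = Some (put l (get a s) s)"
| "run (Arith f l a b) s =
     map_option (\<lambda>r. tick (put l r s)) (apply_op f (get a s) (get b s))"
| "run (Seq p q) s = Option.bind (run p s) (run q)"
| "run (IfLe a b p q) s = (if get a s \<le> get b s then run p (tick s) else run q (tick s))"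
| "run (For v m p) s =
     fold (\<lambda>k r. Option.bind r (\<lambda>s'. run p (set_idx v k s'))) [0..<ival m s] (Some s)"

text \<open>Memory layout of an instance and a current iterate. Everything else in the state
  is unspecified.\<close>

definition encodes ::
  "nat \<Rightarrow> nat \<Rightarrow> real \<Rightarrow> (nat \<Rightarrow> real vec) \<Rightarrow> (nat \<Rightarrow> real) \<Rightarrow> nat set \<Rightarrow> real vec \<Rightarrow> state \<Rightarrow> bool" where
  "encodes n d lam x y I \<alpha> s \<longleftrightarrow>
     idx s ''n'' = n \<and> idx s ''d'' = d \<and>
     mem s ''lam'' 0 0 = lam \<and>
     (\<forall>i<n. \<forall>h<d. mem s ''x'' i h = x i $ h) \<and>
     (\<forall>i<n. mem s ''y'' i 0 = y i) \<and>
     (\<forall>h<d. mem s ''I'' h 0 = (if h \<in> I then 1 else 0)) \<and>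
     (\<forall>i<n. mem s ''alpha'' i 0 = \<alpha> $ i)"

text \<open>Started with iterate \<open>\<alpha>\<close> in memory, \<open>p\<close> terminates without failure after at most \<open>b\<close>
  operations with exact maximizers \<open>u\<close> and \<open>\<eta>\<close>, and with \<open>\<alpha>\<close> overwritten by the next iterate.
  The instance is left intact, so that \<open>p\<close> can be run again.\<close>

definition performs_fw_step ::
  "prog \<Rightarrow> real \<Rightarrow> nat \<Rightarrow> nat \<Rightarrow> real \<Rightarrow> (nat \<Rightarrow> real vec) \<Rightarrow> (nat \<Rightarrow> real) \<Rightarrow> nat set \<Rightarrow> real vec \<Rightarrow> bool" where
  "performs_fw_step p b n d lam x y I \<alpha> \<longleftrightarrow>
     (\<forall>s. encodes n d lam x y I \<alpha> s \<and> ops s = 0 \<longrightarrow>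
        (\<exists>s' \<alpha>'. run p s = Some s' \<and> real (ops s') \<le> b \<and>
           encodes n d lam x y I \<alpha>' s' \<and>
           fw_step n d lam x y I \<alpha> (vec n (\<lambda>i. mem s' ''u'' i 0)) (mem s' ''eta'' 0 0) \<alpha>'))"

end

theory Submission
  imports Defs
begin

text \<open>
  Along a segment the dual lies below its tangent and above the tangent minus \<open>s\<^sup>2 / 2 * (R\<^sup>2 / \<lambda>)\<close>,
  since \<open>\<parallel>X q\<parallel> \<le> n R\<close> for every difference \<open>q\<close> of two points of the box. These two bounds yield the
  gradient, and they give the gap recursion \<open>g' \<le> (1 - \<gamma>) g + \<gamma>\<^sup>2 / 2 * (R\<^sup>2 / \<lambda>)\<close> of Frank-Wolfe, whence
  \<open>g \<le> 2 (R\<^sup>2 / \<lambda>) / (t + 2)\<close> with \<open>\<gamma> = 2 / (t + 1)\<close>.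

  For the line search, the derivative of the dual along a segment is nonincreasing and piecewise
  linear with one breakpoint per coordinate. Starting from \<open>[0, 1]\<close>, the bracket is cut at each
  breakpoint that it contains, on the side given by the sign of the derivative there. Each cut costs
  \<open>O(d)\<close>, so all of them cost \<open>O(d\<^sup>2) = O(n d)\<close> and no sorting is needed. On the final
  bracket the derivative is affine, and its zero is found by one division.
\<close>

section \<open>Concavity and smoothness of the dual\<close>

text \<open>Coordinate \<open>h\<close> of the projection onto \<open>orthant d I\<close>. Half its
  square has derivative \<open>clip I h v\<close>, so the dual is differentiable although the
  projection has kinks.\<close>

definition clip :: "nat set \<Rightarrow> nat \<Rightarrow> real \<Rightarrow> real" where
  "clip I h v = (if h \<in> I then max 0 v else v)"

text \<open>The squared clip is convex, with a 2-Lipschitz derivative \<open>2 * clip I h a\<close>.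
  The cases record which branch of \<open>clip\<close> applies at \<open>a\<close> and at
  \<open>a + b\<close>.\<close>

lemma clip_sq_bounds:
  shows clip_sq_ge: "(clip I h a)\<^sup>2 + 2 * clip I h a * b \<le> (clip I h (a + b))\<^sup>2"
    and clip_sq_le: "(clip I h (a + b))\<^sup>2 \<le> (clip I h a)\<^sup>2 + 2 * clip I h a * b + b\<^sup>2"
proof -
  let ?P = "\<lambda>c c'. c\<^sup>2 + 2 * c * b \<le> c'\<^sup>2 \<and> c'\<^sup>2 \<le> c\<^sup>2 + 2 * c * b + b\<^sup>2"
  have sq: "(a + b)\<^sup>2 = a\<^sup>2 + 2 * a * b + b\<^sup>2" by (simp add: power2_eq_square algebra_simps)
  consider "clip I h a = a" "clip I h (a + b) = a + b"
    | "clip I h a = a" "clip I h (a + b) = 0" "0 \<le> a" "a + b \<le> 0"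
    | "clip I h a = 0" "clip I h (a + b) = a + b" "a \<le> 0" "0 \<le> a + b"
    | "clip I h a = 0" "clip I h (a + b) = 0"
    by (cases "h \<in> I"; cases "0 \<le> a"; cases "0 \<le> a + b") (auto simp: clip_def)
  then have "?P (clip I h a) (clip I h (a + b))"
  proof cases
    case 1
    then show ?thesis by (simp add: sq)
  next
    case 2
    have "a * (a + 2 * b) \<le> 0" using 2(3,4) by (intro mult_nonneg_nonpos) auto
    then have "a\<^sup>2 + 2 * a * b \<le> 0" by (simp add: power2_eq_square algebra_simps)
    moreover have "0 \<le> a\<^sup>2 + 2 * a * b + b\<^sup>2" using sq zero_le_power2[of "a + b"] by linarith
    ultimately show ?thesis by (simp add: 2(1,2))
  next
    case 3
    have "(a + b)\<^sup>2 \<le> b\<^sup>2" using 3(3,4) by (intro power_mono) auto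
    then show ?thesis by (simp add: 3(1,2))
  next
    case 4
    then show ?thesis by simp
  qed
  then show "(clip I h a)\<^sup>2 + 2 * clip I h a * b \<le> (clip I h (a + b))\<^sup>2"
    and "(clip I h (a + b))\<^sup>2 \<le> (clip I h a)\<^sup>2 + 2 * clip I h a * b + b\<^sup>2"
    by simp_all
qed

text \<open>The difference quotient stays within \<open>\<bar>c\<bar> * \<bar>h\<bar>\<close> of
  \<open>m\<close>. This yields the gradient without differentiating \<open>clip\<close>
  piecewise.\<close>

lemma DERIV_from_quadratic_bounds:
  fixes f :: "real \<Rightarrow> real"
  assumes up: "\<And>s. f s \<le> f 0 + s * m" and low: "\<And>s. f 0 + s * m - s\<^sup>2 * c \<le> f s"
  shows "(f has_real_derivative m) (at 0)"
proof -
  have "\<bar>(f h - f 0) / h - m\<bar> \<le> \<bar>c\<bar> * \<bar>h\<bar>" if "h \<noteq> 0" for h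
  proof -
    have "\<bar>f h - f 0 - h * m\<bar> \<le> \<bar>h\<^sup>2 * c\<bar>" using up[of h] low[of h] by linarith
    also have "\<dots> = \<bar>h\<bar> * (\<bar>c\<bar> * \<bar>h\<bar>)" by (simp add: abs_mult power2_eq_square)
    also have "f h - f 0 - h * m = h * ((f h - f 0) / h - m)"
      using that by (simp add: field_simps)
    finally have "\<bar>h\<bar> * \<bar>(f h - f 0) / h - m\<bar> \<le> \<bar>h\<bar> * (\<bar>c\<bar> * \<bar>h\<bar>)"
      by (simp only: abs_mult)
    then show ?thesis using that by (simp add: mult_le_cancel_left)
  qed
  then have "\<forall>\<^sub>F h in at 0. norm ((f h - f 0) / h - m) \<le> \<bar>c\<bar> * \<bar>h\<bar>"
    by (simp add: eventually_at_filter)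
  moreover have "((\<lambda>h. \<bar>c\<bar> * \<bar>h\<bar>) \<longlongrightarrow> 0) (at (0::real))"
    by (rule tendsto_eq_intros refl | simp)+
  ultimately have "((\<lambda>h. (f h - f 0) / h - m) \<longlongrightarrow> 0) (at 0)"
    by (rule Lim_null_comparison)
  then have "((\<lambda>h. (f h - f 0) / h) \<longlongrightarrow> m) (at 0)" by (simp add: LIM_zero_iff)
  then show ?thesis by (simp add: DERIV_def)
qed

section \<open>The dual and its directional derivative in coordinates\<close>

locale svm_instance =
  fixes n d :: nat and lam :: real and x :: "nat \<Rightarrow> real vec" and y :: "nat \<Rightarrow> real" and I :: "nat set"
  assumes valid: "valid_instance n d lam x y I"
begin

lemma n_pos: "0 < n" and d_pos: "0 < d" and lam_pos: "0 < lam"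
  using valid by (auto simp: valid_instance_def)

lemma dim_x [simp]: "i < n \<Longrightarrow> dim_vec (x i) = d"
  using valid by (auto simp: valid_instance_def)

abbreviation D :: "real vec \<Rightarrow> real" where
  "D \<equiv> svm_dual n d lam x y I"

definition preproj :: "real vec \<Rightarrow> nat \<Rightarrow> real" where
  "preproj \<alpha> h = (\<Sum>i<n. y i * x i $ h * \<alpha> $ i) / (lam * real n)"

text \<open>The directional derivative of \<open>D\<close> at \<open>\<alpha>\<close> along
  \<open>q\<close>. In this form it needs only \<open>preproj \<alpha>\<close>,
  \<open>preproj q\<close> and the sum of \<open>q\<close>, hence \<open>O(d)\<close> operations
  once these are known.\<close>

definition slope :: "real vec \<Rightarrow> real vec \<Rightarrow> real" where
  "slope \<alpha> q = (\<Sum>i<n. q $ i) / real n - lam * (\<Sum>h<d. clip I h (preproj \<alpha> h) * preproj q h)"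

lemma preproj_add:
  assumes "\<alpha> \<in> carrier_vec n" "q \<in> carrier_vec n"
  shows "preproj (\<alpha> + s \<cdot>\<^sub>v q) h = preproj \<alpha> h + s * preproj q h"
proof -
  have "(\<Sum>i<n. y i * x i $ h * (\<alpha> + s \<cdot>\<^sub>v q) $ i) =
      (\<Sum>i<n. y i * x i $ h * \<alpha> $ i) + s * (\<Sum>i<n. y i * x i $ h * q $ i)"
    using assms by (simp add: sum.distrib[symmetric] sum_distrib_left algebra_simps)
  then show ?thesis by (simp add: preproj_def add_divide_distrib)
qed

lemma svm_dual_eq:
  assumes "\<alpha> \<in> carrier_vec n"
  shows "D \<alpha> = (\<Sum>i<n. \<alpha> $ i) / real n - lam / 2 * (\<Sum>h<d. (clip I h (preproj \<alpha> h))\<^sup>2)"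
proof -
  let ?v = "(1 / (lam * real n)) \<cdot>\<^sub>v (data_mat n d x y *\<^sub>v \<alpha>)"
  have I: "I \<subseteq> {..<d}" using valid by (simp add: valid_instance_def)
  have v: "?v \<in> carrier_vec d" by (intro carrier_vecI) (simp add: data_mat_def)
  have "?v $ h = preproj \<alpha> h" if "h < d" for h
    using that assms
    by (simp add: data_mat_def preproj_def scalar_prod_def lessThan_atLeast0 mult.assoc)
  then have "primal_of n d lam x y I \<alpha> = vec d (\<lambda>h. clip I h (preproj \<alpha> h))"
    unfolding primal_of_def eproj_orthant[OF v I] clip_def by (intro eq_vecI) auto
  then show ?thesis using assms
    by (simp add: svm_dual_def vnorm_sq scalar_prod_def lessThan_atLeast0)
qed

text \<open>Concavity, by \<open>clip_sq_ge\<close> in each coordinate. The step \<open>s\<close>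
  may have either sign, which the line search exploits.\<close>

lemma svm_dual_le:
  assumes "\<alpha> \<in> carrier_vec n" "q \<in> carrier_vec n"
  shows "D (\<alpha> + s \<cdot>\<^sub>v q) \<le> D \<alpha> + s * slope \<alpha> q"
proof -
  have "(\<Sum>h<d. (clip I h (preproj \<alpha> h))\<^sup>2 + 2 * s * (clip I h (preproj \<alpha> h) * preproj q h))
      \<le> (\<Sum>h<d. (clip I h (preproj \<alpha> h + s * preproj q h))\<^sup>2)"
  proof (rule sum_mono)
    fix h
    show "(clip I h (preproj \<alpha> h))\<^sup>2 + 2 * s * (clip I h (preproj \<alpha> h) * preproj q h)
        \<le> (clip I h (preproj \<alpha> h + s * preproj q h))\<^sup>2"
      using clip_sq_ge[of I h "preproj \<alpha> h" "s * preproj q h"] by (simp add: mult_ac)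
  qed
  then have "lam / 2 * ((\<Sum>h<d. (clip I h (preproj \<alpha> h))\<^sup>2) +
        2 * s * (\<Sum>h<d. clip I h (preproj \<alpha> h) * preproj q h))
      \<le> lam / 2 * (\<Sum>h<d. (clip I h (preproj \<alpha> h + s * preproj q h))\<^sup>2)"
    using lam_pos by (intro mult_left_mono) (simp_all add: sum.distrib sum_distrib_left)
  moreover have "(\<Sum>i<n. (\<alpha> + s \<cdot>\<^sub>v q) $ i) = (\<Sum>i<n. \<alpha> $ i) + s * (\<Sum>i<n. q $ i)"
    using assms by (simp add: sum.distrib sum_distrib_left)
  ultimately show ?thesis using assms
    by (simp add: svm_dual_eq preproj_add slope_def add_divide_distrib algebra_simps)
qed

text \<open>Smoothness, by \<open>clip_sq_le\<close>. The quadratic coefficient depends on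
  \<open>q\<close> alone and is controlled by \<open>preproj_sq_le\<close>.\<close>

lemma svm_dual_ge:
  assumes "\<alpha> \<in> carrier_vec n" "q \<in> carrier_vec n"
  shows "D \<alpha> + s * slope \<alpha> q - s\<^sup>2 * (lam / 2 * (\<Sum>h<d. (preproj q h)\<^sup>2)) \<le> D (\<alpha> + s \<cdot>\<^sub>v q)"
proof -
  have "(\<Sum>h<d. (clip I h (preproj \<alpha> h + s * preproj q h))\<^sup>2) \<le>
      (\<Sum>h<d. (clip I h (preproj \<alpha> h))\<^sup>2 + 2 * s * (clip I h (preproj \<alpha> h) * preproj q h)
        + s\<^sup>2 * (preproj q h)\<^sup>2)"
  proof (rule sum_mono)
    fix h
    show "(clip I h (preproj \<alpha> h + s * preproj q h))\<^sup>2 \<le>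
        (clip I h (preproj \<alpha> h))\<^sup>2 + 2 * s * (clip I h (preproj \<alpha> h) * preproj q h)
        + s\<^sup>2 * (preproj q h)\<^sup>2"
      using clip_sq_le[of I h "preproj \<alpha> h" "s * preproj q h"]
      by (simp add: mult_ac power_mult_distrib)
  qed
  then have "lam / 2 * (\<Sum>h<d. (clip I h (preproj \<alpha> h + s * preproj q h))\<^sup>2) \<le>
      lam / 2 * ((\<Sum>h<d. (clip I h (preproj \<alpha> h))\<^sup>2) +
        2 * s * (\<Sum>h<d. clip I h (preproj \<alpha> h) * preproj q h) + s\<^sup>2 * (\<Sum>h<d. (preproj q h)\<^sup>2))"
    using lam_pos by (intro mult_left_mono) (simp_all add: sum.distrib sum_distrib_left)
  moreover have "(\<Sum>i<n. (\<alpha> + s \<cdot>\<^sub>v q) $ i) = (\<Sum>i<n. \<alpha> $ i) + s * (\<Sum>i<n. q $ i)"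
    using assms by (simp add: sum.distrib sum_distrib_left)
  ultimately show ?thesis using assms
    by (simp add: svm_dual_eq preproj_add slope_def add_divide_distrib algebra_simps)
qed

section \<open>The gradient of the dual and its curvature constant\<close>

definition dual_grad :: "real vec \<Rightarrow> nat \<Rightarrow> real" where
  "dual_grad \<alpha> i = (1 - y i * (\<Sum>h<d. x i $ h * clip I h (preproj \<alpha> h))) / real n"

text \<open>Exchanging the sums over examples and coordinates; \<open>lam\<close> cancels against
  the denominator in \<open>preproj q\<close>.\<close>

lemma slope_eq: "slope \<alpha> q = (\<Sum>i<n. dual_grad \<alpha> i * q $ i)"
proof -
  have grad_mult: "dual_grad \<alpha> i * q $ i = q $ i / real n -
      (\<Sum>h<d. clip I h (preproj \<alpha> h) * (y i * x i $ h * q $ i)) / real n" for i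
    by (simp add: dual_grad_def diff_divide_distrib sum_distrib_left sum_distrib_right algebra_simps)
  have "lam * (\<Sum>h<d. clip I h (preproj \<alpha> h) * preproj q h)
      = (\<Sum>h<d. \<Sum>i<n. clip I h (preproj \<alpha> h) * (y i * x i $ h * q $ i)) / real n"
    using lam_pos by (simp add: preproj_def sum_distrib_left sum_divide_distrib)
  also have "\<dots> = (\<Sum>i<n. \<Sum>h<d. clip I h (preproj \<alpha> h) * (y i * x i $ h * q $ i)) / real n"
    by (subst sum.swap) simp
  finally show ?thesis
    by (simp add: slope_def grad_mult sum_subtractf sum_divide_distrib)
qed

text \<open>Along each unit vector the dual is squeezed between its tangent and a touching parabola,
  so the derivative that \<open>deriv\<close> selects really exists.\<close>

lemma grad_svm_dual:
  assumes a: "\<alpha> \<in> carrier_vec n"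
  shows "grad n D \<alpha> = vec n (dual_grad \<alpha>)"
proof -
  have "deriv (\<lambda>s. D (\<alpha> + s \<cdot>\<^sub>v unit_vec n i)) 0 = dual_grad \<alpha> i" if i: "i < n" for i
  proof (rule DERIV_imp_deriv, rule DERIV_from_quadratic_bounds)
    have e: "unit_vec n i \<in> carrier_vec n" by simp
    have "slope \<alpha> (unit_vec n i) = dual_grad \<alpha> i"
      using i by (simp add: slope_eq unit_vec_def if_distrib cong: if_cong)
    moreover have "\<alpha> + 0 \<cdot>\<^sub>v unit_vec n i = \<alpha>" using a by (intro eq_vecI) auto
    ultimately show "D (\<alpha> + s \<cdot>\<^sub>v unit_vec n i) \<le> D (\<alpha> + 0 \<cdot>\<^sub>v unit_vec n i) + s * dual_grad \<alpha> i"
      and "D (\<alpha> + 0 \<cdot>\<^sub>v unit_vec n i) + s * dual_grad \<alpha> i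
        - s\<^sup>2 * (lam / 2 * (\<Sum>h<d. (preproj (unit_vec n i) h)\<^sup>2)) \<le> D (\<alpha> + s \<cdot>\<^sub>v unit_vec n i)" for s
      using svm_dual_le[OF a e, of s] svm_dual_ge[OF a e, of s] by simp_all
  qed
  then show ?thesis by (intro eq_vecI) (simp_all add: grad_def)
qed

lemma grad_scalar_prod:
  assumes "\<alpha> \<in> carrier_vec n" "v \<in> carrier_vec n"
  shows "grad n D \<alpha> \<bullet> v = slope \<alpha> v"
  using assms by (simp add: grad_svm_dual scalar_prod_def slope_eq lessThan_atLeast0)

lemma slope_diff:
  assumes "u \<in> carrier_vec n" "v \<in> carrier_vec n"
  shows "slope \<alpha> (u - v) = slope \<alpha> u - slope \<alpha> v"
  using assms by (simp add: slope_eq sum_subtractf right_diff_distrib)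

text \<open>Cauchy-Schwarz over the \<open>n\<close> examples, with labels that square to 1, bounds
  the squared norm of \<open>X q\<close> by \<open>n\<^sup>2 * R\<^sup>2\<close>.\<close>

lemma preproj_sq_le:
  assumes R: "\<And>i. i < n \<Longrightarrow> vnorm (x i) \<le> R" and q: "\<And>i. i < n \<Longrightarrow> \<bar>q $ i\<bar> \<le> 1"
  shows "lam * (\<Sum>h<d. (preproj q h)\<^sup>2) \<le> R\<^sup>2 / lam"
proof -
  have y: "(y i)\<^sup>2 = 1" if "i < n" for i
    using valid that by (force simp: valid_instance_def)
  have "(\<Sum>h<d. (\<Sum>i<n. y i * x i $ h * q $ i)\<^sup>2) \<le> (\<Sum>h<d. real n * (\<Sum>i<n. (y i * x i $ h * q $ i)\<^sup>2))"
    using sum_squared_le_sum_of_squares[where I = "{..<n}"]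
    by (intro sum_mono) (simp add: mult.commute)
  also have "\<dots> = real n * (\<Sum>i<n. \<Sum>h<d. (y i * x i $ h * q $ i)\<^sup>2)"
    by (subst sum.swap) (simp add: sum_distrib_left)
  also have "\<dots> = real n * (\<Sum>i<n. (q $ i)\<^sup>2 * (vnorm (x i))\<^sup>2)"
    by (simp add: vnorm_sq power_mult_distrib y sum_distrib_left mult_ac)
  also have "\<dots> \<le> real n * (\<Sum>i<n. 1 * R\<^sup>2)"
    using R q vnorm_nonneg
    by (intro mult_left_mono sum_mono mult_mono power_mono) (auto simp: abs_square_le_1)
  finally have "(\<Sum>h<d. (\<Sum>i<n. y i * x i $ h * q $ i)\<^sup>2) \<le> (real n)\<^sup>2 * R\<^sup>2"
    by (simp add: power2_eq_square)
  then have "(\<Sum>h<d. (\<Sum>i<n. y i * x i $ h * q $ i)\<^sup>2) / (lam * (real n)\<^sup>2)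
      \<le> (real n)\<^sup>2 * R\<^sup>2 / (lam * (real n)\<^sup>2)"
    using lam_pos by (intro divide_right_mono) auto
  also have "\<dots> = R\<^sup>2 / lam" using n_pos by simp
  also have "(\<Sum>h<d. (\<Sum>i<n. y i * x i $ h * q $ i)\<^sup>2) / (lam * (real n)\<^sup>2)
      = lam * (\<Sum>h<d. (preproj q h)\<^sup>2)"
    using lam_pos
    by (simp add: preproj_def power_divide sum_divide_distrib[symmetric] power_mult_distrib)
      (simp add: power2_eq_square)
  finally show ?thesis .
qed

subsection \<open>Convergence rate\<close>

lemma box01_segment:
  assumes "\<alpha> \<in> box01 n" "u \<in> box01 n" "e \<in> {0..1}"
  shows "\<alpha> + e \<cdot>\<^sub>v (u - \<alpha>) \<in> box01 n"
proof -
  have "\<alpha> $ i + e * (u $ i - \<alpha> $ i) \<in> {0..1}" if "i < n" for i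
  proof -
    have "\<alpha> $ i + e * (u $ i - \<alpha> $ i) = (1 - e) * \<alpha> $ i + e * u $ i" by (simp add: algebra_simps)
    moreover have "(1 - e) * \<alpha> $ i + e * u $ i \<le> 1"
      using assms that by (intro convex_bound_le) (auto simp: box01_def)
    ultimately show ?thesis using assms that by (auto simp: box01_def)
  qed
  then show ?thesis using assms by (auto simp: box01_def)
qed

text \<open>Concavity and the choice of \<open>u\<close> bound the gap by the slope along
  \<open>u - \<alpha>\<close>; smoothness turns this slope into progress. Exact line search is at
  least as good as the step \<open>\<gamma>\<close>, which therefore stays free.\<close>

lemma fw_step_progress:
  assumes step: "fw_step n d lam x y I \<alpha> u \<eta> \<alpha>'" and \<alpha>: "\<alpha> \<in> box01 n"
    and R: "\<And>i. i < n \<Longrightarrow> vnorm (x i) \<le> R"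
    and star: "\<alpha>star \<in> box01 n" and \<gamma>: "\<gamma> \<in> {0..1}"
  shows "D \<alpha>star - D \<alpha>' \<le> (1 - \<gamma>) * (D \<alpha>star - D \<alpha>) + \<gamma>\<^sup>2 / 2 * (R\<^sup>2 / lam)"
proof -
  have u: "u \<in> box01 n" and umax: "v \<in> box01 n \<Longrightarrow> grad n D \<alpha> \<bullet> v \<le> grad n D \<alpha> \<bullet> u"
    and \<eta>: "e \<in> {0..1} \<Longrightarrow> D (\<alpha> + e \<cdot>\<^sub>v (u - \<alpha>)) \<le> D \<alpha>'" for v e
    using step by (auto simp: fw_step_def is_arg_max_linorder)
  have c: "\<alpha> \<in> carrier_vec n" "u \<in> carrier_vec n" "\<alpha>star \<in> carrier_vec n"
    using \<alpha> u star by (auto simp: box01_def)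
  define q where "q = u - \<alpha>"
  have q: "q \<in> carrier_vec n" using c by (simp add: q_def)
  have "\<bar>q $ i\<bar> \<le> 1" if "i < n" for i
  proof -
    have "u $ i \<in> {0..1}" "\<alpha> $ i \<in> {0..1}" using u \<alpha> that by (auto simp: box01_def)
    then show ?thesis using c that by (auto simp: q_def abs_le_iff)
  qed
  then have curv: "lam * (\<Sum>h<d. (preproj q h)\<^sup>2) \<le> R\<^sup>2 / lam"
    using preproj_sq_le R by blast
  have "\<alpha> + 1 \<cdot>\<^sub>v (\<alpha>star - \<alpha>) = \<alpha>star" using c by (intro eq_vecI) auto
  then have "D \<alpha>star - D \<alpha> \<le> slope \<alpha> (\<alpha>star - \<alpha>)"
    using svm_dual_le[of \<alpha> "\<alpha>star - \<alpha>" 1] c by simp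
  also have "\<dots> \<le> slope \<alpha> q"
    using umax[OF star] c by (simp add: q_def slope_diff grad_scalar_prod)
  finally have "\<gamma> * (D \<alpha>star - D \<alpha>) \<le> \<gamma> * slope \<alpha> q" using \<gamma> by (intro mult_left_mono) auto
  moreover have "\<gamma>\<^sup>2 / 2 * (lam * (\<Sum>h<d. (preproj q h)\<^sup>2)) \<le> \<gamma>\<^sup>2 / 2 * (R\<^sup>2 / lam)"
    using curv by (intro mult_left_mono) auto
  moreover have "D \<alpha> + \<gamma> * slope \<alpha> q - \<gamma>\<^sup>2 * (lam / 2 * (\<Sum>h<d. (preproj q h)\<^sup>2)) \<le> D \<alpha>'"
    using svm_dual_ge[of \<alpha> q \<gamma>] \<eta>[OF \<gamma>] c q by (simp add: q_def)
  ultimately show ?thesis by (simp add: algebra_simps)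
qed

text \<open>Exact line search does at least as well as the step size \<open>2 / (t + 1)\<close>, which equals 1 at
  \<open>t = 1\<close>; hence the starting point does not matter.\<close>

lemma fw_run_rate:
  assumes fw: "fw_run n d lam x y I \<alpha> u \<eta>"
    and R: "\<And>i. i < n \<Longrightarrow> vnorm (x i) \<le> R" and star: "\<alpha>star \<in> box01 n"
  shows "D \<alpha>star - D (\<alpha> (Suc t)) \<le> 2 * (R\<^sup>2 / lam) / (real t + 3)"
proof -
  define C where "C = R\<^sup>2 / lam"
  have C: "0 \<le> C" using lam_pos by (simp add: C_def)
  have step: "fw_step n d lam x y I (\<alpha> t) (u (Suc t)) (\<eta> (Suc t)) (\<alpha> (Suc t))" for t
    using fw by (auto simp: fw_run_def dest: spec[of _ "Suc t"])
  have box: "\<alpha> t \<in> box01 n" for t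
  proof (induction t)
    case 0 then show ?case using fw by (simp add: fw_run_def)
  next
    case (Suc t) then show ?case
      using step[of t] by (auto simp: fw_step_def is_arg_max_def intro!: box01_segment)
  qed
  have prog: "D \<alpha>star - D (\<alpha> (Suc t)) \<le> (1 - \<gamma>) * (D \<alpha>star - D (\<alpha> t)) + \<gamma>\<^sup>2 / 2 * C"
    if "\<gamma> \<in> {0..1}" for \<gamma> t
    unfolding C_def by (rule fw_step_progress[OF step box R star that])
  have "D \<alpha>star - D (\<alpha> (Suc t)) \<le> 2 * C / (real t + 3)"
  proof (induction t)
    case 0
    show ?case using prog[of 1 0] C by simp
  next
    case (Suc t)
    define r where "r = real t"
    have r: "0 \<le> r" by (simp add: r_def)
    \<comment> \<open>The iterate produced here has number \<open>t + 2\<close>, so the comparison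
      step is \<open>2 / (t + 3)\<close>.\<close>
    have "D \<alpha>star - D (\<alpha> (Suc (Suc t))) \<le>
        (1 - 2 / (r + 3)) * (D \<alpha>star - D (\<alpha> (Suc t))) + (2 / (r + 3))\<^sup>2 / 2 * C"
      using r by (intro prog) auto
    also have "\<dots> \<le> (1 - 2 / (r + 3)) * (2 * C / (r + 3)) + (2 / (r + 3))\<^sup>2 / 2 * C"
      using Suc r by (intro add_right_mono mult_left_mono) (auto simp: r_def)
    also have "\<dots> = C * (2 * (r + 2) / (r + 3)\<^sup>2)"
      using r by (simp add: divide_simps) (simp add: power2_eq_square algebra_simps)
    also have "\<dots> \<le> C * (2 / (r + 4))"
    proof (rule mult_left_mono[OF _ C])
      \<comment> \<open>The left side is \<open>2 * ((r + 3)\<^sup>2 - 1)\<close>.\<close>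
      have "2 * (r + 2) * (r + 4) \<le> 2 * (r + 3)\<^sup>2"
        by (simp add: power2_eq_square algebra_simps)
      then show "2 * (r + 2) / (r + 3)\<^sup>2 \<le> 2 / (r + 4)" using r by (simp add: frac_le_eq divide_simps)
    qed
    finally show ?case by (simp add: r_def mult_ac add_ac)
  qed
  then show ?thesis by (simp add: C_def)
qed

text \<open>The bound on \<open>T\<close> is
  \<open>2 * (R\<^sup>2 / lam) / (T + 2) \<le> \<epsilon>\<close> solved for \<open>T\<close>; with
  \<open>T = Suc t\<close> the denominator is \<open>t + 3\<close>.\<close>

lemma fw_run_gap:
  assumes fw: "fw_run n d lam x y I \<alpha> u \<eta>"
    and R: "\<And>i. i < n \<Longrightarrow> vnorm (x i) \<le> R" and star: "\<alpha>star \<in> box01 n"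
    and \<epsilon>: "0 < \<epsilon>" and T: "1 \<le> T" "2 * R\<^sup>2 / (lam * \<epsilon>) - 2 \<le> real T"
  shows "D \<alpha>star - D (\<alpha> T) \<le> \<epsilon>"
proof -
  obtain t where t: "T = Suc t" using T(1) by (cases T) auto
  have "2 * (R\<^sup>2 / lam) = 2 * R\<^sup>2 / (lam * \<epsilon>) * \<epsilon>" using \<epsilon> by simp
  also have "\<dots> \<le> (real t + 3) * \<epsilon>" using T(2) \<epsilon> by (intro mult_right_mono) (auto simp: t)
  finally have "2 * (R\<^sup>2 / lam) / (real t + 3) \<le> \<epsilon>"
    by (subst pos_divide_le_eq) (simp_all add: mult.commute)
  then show ?thesis using fw_run_rate[OF fw R star, of t] by (simp add: t)
qed

end

section \<open>Correctness and cost of programs\<close>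

text \<open>Total correctness: a failing run satisfies no postcondition. Operation counts are
  bounded separately, through \<open>cost\<close>.\<close>

definition wp :: "prog \<Rightarrow> (state \<Rightarrow> bool) \<Rightarrow> state \<Rightarrow> bool" where
  "wp p Q s \<longleftrightarrow> (\<exists>s'. run p s = Some s' \<and> Q s')"

lemma wp_simps [simp]:
  "wp Skip Q s \<longleftrightarrow> Q s"
  "wp (Lit l k) Q s \<longleftrightarrow> Q (put l (of_int k) s)"
  "wp (Copy l a) Q s \<longleftrightarrow> Q (put l (get a s) s)"
  "wp (Arith Add l a b) Q s \<longleftrightarrow> Q (tick (put l (get a s + get b s) s))"
  "wp (Arith Sub l a b) Q s \<longleftrightarrow> Q (tick (put l (get a s - get b s) s))"
  "wp (Arith Mul l a b) Q s \<longleftrightarrow> Q (tick (put l (get a s * get b s) s))"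
  "wp (Arith Div l a b) Q s \<longleftrightarrow> get b s \<noteq> 0 \<and> Q (tick (put l (get a s / get b s) s))"
  "wp (Seq p q) Q s \<longleftrightarrow> wp p (wp q Q) s"
  "wp (IfLe a b p q) Q s \<longleftrightarrow> (if get a s \<le> get b s then wp p Q (tick s) else wp q Q (tick s))"
  by (auto simp: wp_def bind_eq_Some_conv)

lemma wp_mono: "wp p Q s \<Longrightarrow> (\<And>s'. Q s' \<Longrightarrow> Q' s') \<Longrightarrow> wp p Q' s"
  by (auto simp: wp_def)

lemma state_update_simps [simp]:
  "idx (put l r s) = idx s" "idx (tick s) = idx s" "idx (set_idx v k s) = (idx s)(v := k)"
  "mem (tick s) = mem s" "mem (set_idx v k s) = mem s"
  "mem (put (Loc a i j) r s) b =
     (if b = a then (mem s a)(ival i s := (mem s a (ival i s))(ival j s := r)) else mem s b)"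
  "ops (put l r s) = ops s" "ops (tick s) = Suc (ops s)" "ops (set_idx v k s) = ops s"
  by (cases l; auto simp: tick_def set_idx_def)+

section \<open>Syntactic frame conditions and cost bounds\<close>

primrec loc_array :: "loc \<Rightarrow> string" where
  "loc_array (Loc a i j) = a"

lemma mem_put: "a \<noteq> loc_array l \<Longrightarrow> mem (put l r s) a = mem s a"
  by (cases l) auto

primrec writes :: "prog \<Rightarrow> string set" where
  "writes Skip = {}"
| "writes (Lit l k) = {loc_array l}"
| "writes (Copy l a) = {loc_array l}"
| "writes (Arith f l a b) = {loc_array l}"
| "writes (Seq p q) = writes p \<union> writes q"
| "writes (IfLe a b p q) = writes p \<union> writes q"
| "writes (For v m p) = writes p"

primrec loop_vars :: "prog \<Rightarrow> string set" where
  "loop_vars Skip = {}"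
| "loop_vars (Lit l k) = {}"
| "loop_vars (Copy l a) = {}"
| "loop_vars (Arith f l a b) = {}"
| "loop_vars (Seq p q) = loop_vars p \<union> loop_vars q"
| "loop_vars (IfLe a b p q) = loop_vars p \<union> loop_vars q"
| "loop_vars (For v m p) = insert v (loop_vars p)"

primrec iexp_vars :: "iexp \<Rightarrow> string set" where
  "iexp_vars (Num k) = {}"
| "iexp_vars (Var v) = {v}"

primrec bound_vars :: "prog \<Rightarrow> string set" where
  "bound_vars Skip = {}"
| "bound_vars (Lit l k) = {}"
| "bound_vars (Copy l a) = {}"
| "bound_vars (Arith f l a b) = {}"
| "bound_vars (Seq p q) = bound_vars p \<union> bound_vars q"
| "bound_vars (IfLe a b p q) = bound_vars p \<union> bound_vars q"
| "bound_vars (For v m p) = iexp_vars m \<union> bound_vars p"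

text \<open>An upper bound for the number of operations, provided that no loop bound is itself a
  loop variable.\<close>

primrec cost :: "prog \<Rightarrow> state \<Rightarrow> nat" where
  "cost Skip s = 0"
| "cost (Lit l k) s = 0"
| "cost (Copy l a) s = 0"
| "cost (Arith f l a b) s = 1"
| "cost (Seq p q) s = cost p s + cost q s"
| "cost (IfLe a b p q) s = 1 + cost p s + cost q s"
| "cost (For v m p) s = ival m s * cost p s"

definition frame :: "prog \<Rightarrow> state \<Rightarrow> state \<Rightarrow> bool" where
  "frame p s s' \<longleftrightarrow> (\<forall>a. a \<notin> writes p \<longrightarrow> mem s' a = mem s a) \<and>
     (\<forall>v. v \<notin> loop_vars p \<longrightarrow> idx s' v = idx s v)"

lemma frame_mem: "frame p s s' \<Longrightarrow> a \<notin> writes p \<Longrightarrow> mem s' a = mem s a"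
  and frame_idx: "frame p s s' \<Longrightarrow> v \<notin> loop_vars p \<Longrightarrow> idx s' v = idx s v"
  by (simp_all add: frame_def)

text \<open>The fold propagates failure, so a successful loop has only successful prefixes;
  \<open>P k\<close> speaks of the state after \<open>k\<close> iterations.\<close>

lemma run_For_induct [consumes 1, case_names init step]:
  assumes "run (For v m p) s = Some s'"
    and "P 0 s" and "\<And>k s1 s2. P k s1 \<Longrightarrow> run p (set_idx v k s1) = Some s2 \<Longrightarrow> P (Suc k) s2"
  shows "P (ival m s) s'"
proof -
  have "fold (\<lambda>k r. Option.bind r (\<lambda>s'. run p (set_idx v k s'))) [0..<j] (Some s) = Some s' \<Longrightarrow> P j s'"
    for j s'
    using assms(2,3) by (induction j arbitrary: s') (auto simp: bind_eq_Some_conv)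
  then show ?thesis using assms(1) by simp
qed

lemma run_frame: "run p s = Some s' \<Longrightarrow> frame p s s'"
proof (induction p arbitrary: s s')
  case (For v m p)
  from For.prems show ?case
  proof (induction rule: run_For_induct[where P = "\<lambda>k. frame (For v m p) s"])
    case (step k s1 s2)
    then show ?case using For.IH[OF step(2)] by (auto simp: frame_def)
  qed (simp add: frame_def)
next
  case (Seq p q)
  then show ?case by (fastforce simp: frame_def bind_eq_Some_conv)
next
  case (IfLe a b p q)
  then show ?case by (fastforce simp: frame_def split: if_splits)
qed (auto simp: frame_def mem_put)

text \<open>\<open>cost\<close> reads the state only in loop bounds, and \<open>q\<close> assigns to
  none of their variables.\<close>

lemma frame_cost:
  assumes "frame q s s'" "bound_vars p \<inter> loop_vars q = {}"
  shows "cost p s' = cost p s"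
  using assms(2)
proof (induction p)
  case (For v m p)
  have "ival m s' = ival m s" using assms(1) For.prems by (cases m) (auto simp: frame_def)
  with For show ?case by auto
qed (simp_all add: Int_Un_distrib2)

lemma run_cost:
  assumes "run p s = Some s'" "bound_vars p \<inter> loop_vars p = {}"
  shows "ops s' \<le> ops s + cost p s"
  using assms
proof (induction p arbitrary: s s')
  case (For v m p)
  have fr: "frame p s1 s2" if "run p s1 = Some s2" for s1 s2 using that by (rule run_frame)
  have d: "bound_vars p \<inter> loop_vars (For v m p) = {}" using For.prems(2) by auto
  have "frame (For v m p) s s' \<and> ops s' \<le> ops s + ival m s * cost p s"
    using For.prems(1)
  proof (induction rule: run_For_induct[where
        P = "\<lambda>k s'. frame (For v m p) s s' \<and> ops s' \<le> ops s + k * cost p s"])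
    case (step k s1 s2)
    \<comment> \<open>Each iteration starts within the frame of the loop, so the cost of the body
      evaluated at \<open>s\<close> is valid for all of them.\<close>
    have f: "frame (For v m p) s (set_idx v k s1)" using step(1) by (auto simp: frame_def)
    have "ops s2 \<le> ops s1 + cost p (set_idx v k s1)" using For.IH[OF step(2)] d by auto
    moreover have "frame (For v m p) s s2" using f run_frame[OF step(2)] by (auto simp: frame_def)
    ultimately show ?case using step(1) frame_cost[OF f d] by auto
  qed (simp add: frame_def)
  then show ?case by simp
next
  case (Seq p q)
  obtain s1 where s1: "run p s = Some s1" "run q s1 = Some s'"
    using Seq.prems(1) by (auto simp: bind_eq_Some_conv)
  have "cost q s1 = cost q s"
    using run_frame[OF s1(1)] Seq.prems(2) by (intro frame_cost) auto
  moreover have "ops s1 \<le> ops s + cost p s" "ops s' \<le> ops s1 + cost q s1"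
    using Seq.IH(1)[OF s1(1)] Seq.IH(2)[OF s1(2)] Seq.prems(2) by auto
  ultimately show ?case by simp
next
  case (IfLe a b p q)
  have eq: "cost r (tick s) = cost r s" for r
    by (rule frame_cost[of Skip]) (auto simp: frame_def)
  show ?case using IfLe.prems IfLe.IH[of "tick s" s'] by (auto simp: eq Int_Un_distrib Int_Un_distrib2 split: if_splits)
qed auto

lemma wp_frame: "wp p Q s \<Longrightarrow> wp p (\<lambda>s'. Q s' \<and> frame p s s') s"
  by (auto simp: wp_def run_frame)

text \<open>The frame relative to the entry state is supplied in \<open>step\<close> and
  \<open>post\<close>, so an invariant has to describe only what the loop writes.\<close>

lemma wp_For:
  assumes "Inv 0 s"
    and step: "\<And>k s'. k < ival m s \<Longrightarrow> frame (For v m p) s s' \<Longrightarrow> Inv k s' \<Longrightarrow>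
      wp p (Inv (Suc k)) (set_idx v k s')"
    and post: "\<And>s'. frame (For v m p) s s' \<Longrightarrow> Inv (ival m s) s' \<Longrightarrow> Q s'"
  shows "wp (For v m p) Q s"
proof -
  define loop where
    "loop j = fold (\<lambda>k r. Option.bind r (\<lambda>s'. run p (set_idx v k s'))) [0..<j] (Some s)" for j
  have "\<exists>s'. loop j = Some s' \<and> frame (For v m p) s s' \<and> Inv j s'" if "j \<le> ival m s" for j
    using that
  proof (induction j)
    case 0
    then show ?case using assms(1) by (auto simp: loop_def frame_def)
  next
    case (Suc j)
    then obtain s1 where s1: "loop j = Some s1" "frame (For v m p) s s1" "Inv j s1" by auto
    with step[of j s1] Suc.prems obtain s2 where s2: "run p (set_idx v j s1) = Some s2" "Inv (Suc j) s2"
      by (auto simp: wp_def)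
    have "frame (For v m p) s s2" using s1(2) run_frame[OF s2(1)] by (auto simp: frame_def)
    then show ?case using s1 s2 by (auto simp: loop_def)
  qed
  from this[of "ival m s"] show ?thesis using post by (auto simp: wp_def loop_def)
qed

section \<open>A program for one Frank-Wolfe step\<close>

primrec block :: "prog list \<Rightarrow> prog" where
  "block [] = Skip"
| "block (p # ps) = Seq p (block ps)"

abbreviation scalar :: "string \<Rightarrow> loc" where
  "scalar a \<equiv> Loc a (Num 0) (Num 0)"

abbreviation entry :: "string \<Rightarrow> string \<Rightarrow> loc" where
  "entry a v \<equiv> Loc a (Var v) (Num 0)"

text \<open>Integer variables are only indices and loop bounds, so \<open>n\<close> becomes a real
  number by adding 1 in a loop of length \<open>n\<close>.\<close>

definition count_prog :: prog where
  "count_prog = block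
     [Lit (scalar ''zero'') 0, Lit (scalar ''one'') 1, Lit (scalar ''nr'') 0,
      For ''i'' (Var ''n'') (Arith Add (scalar ''nr'') (scalar ''nr'') (scalar ''one'')),
      Arith Mul (scalar ''c'') (scalar ''lam'') (scalar ''nr'')]"

definition preproj_prog :: "string \<Rightarrow> string \<Rightarrow> prog" where
  "preproj_prog src dst = For ''h'' (Var ''d'') (block
     [Lit (entry dst ''h'') 0,
      For ''i'' (Var ''n'') (block
        [Arith Mul (scalar ''t'') (entry ''y'' ''i'') (Loc ''x'' (Var ''i'') (Var ''h'')),
         Arith Mul (scalar ''t'') (scalar ''t'') (entry src ''i''),
         Arith Add (entry dst ''h'') (entry dst ''h'') (scalar ''t'')]),
      Arith Div (entry dst ''h'') (entry dst ''h'') (scalar ''c'')])"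

text \<open>Membership in \<open>I\<close> is stored as 0 or 1, so comparison with zero decides
  it.\<close>

definition clip_prog :: "loc \<Rightarrow> string \<Rightarrow> prog" where
  "clip_prog l v = IfLe (entry ''I'' v) (scalar ''zero'') Skip
     (IfLe l (scalar ''zero'') (Lit l 0) Skip)"

text \<open>A linear function on the box is maximized coordinatewise by the sign of its coefficient.
  Here the coefficient is nonnegative iff the margin in \<open>t\<close> is at most 1; ties go to 1.
  Finally \<open>sq\<close> holds the sum of \<open>u - \<alpha>\<close> divided by
  \<open>n\<close>.\<close>

definition vertex_prog :: prog where
  "vertex_prog = block
     [Lit (scalar ''sq'') 0,
      For ''i'' (Var ''n'') (block
        [Lit (scalar ''t'') 0,
         For ''h'' (Var ''d'') (block
           [Copy (scalar ''r'') (entry ''a'' ''h''),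
            clip_prog (scalar ''r'') ''h'',
            Arith Mul (scalar ''r'') (Loc ''x'' (Var ''i'') (Var ''h'')) (scalar ''r''),
            Arith Add (scalar ''t'') (scalar ''t'') (scalar ''r'')]),
         Arith Mul (scalar ''t'') (entry ''y'' ''i'') (scalar ''t''),
         IfLe (scalar ''t'') (scalar ''one'') (Lit (entry ''u'' ''i'') 1) (Lit (entry ''u'' ''i'') 0),
         Arith Sub (entry ''q'' ''i'') (entry ''u'' ''i'') (entry ''alpha'' ''i''),
         Arith Add (scalar ''sq'') (scalar ''sq'') (entry ''q'' ''i'')]),
      Arith Div (scalar ''sq'') (scalar ''sq'') (scalar ''nr'')]"

text \<open>The loop variable is \<open>k\<close> because the program also runs inside the loop over
  \<open>h\<close> of \<open>bracket_prog\<close>.\<close>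

definition slope_prog :: "string \<Rightarrow> string \<Rightarrow> prog" where
  "slope_prog e g = block
     [Lit (scalar g) 0,
      For ''k'' (Var ''d'') (block
        [Arith Mul (scalar ''t'') (scalar e) (entry ''b'' ''k''),
         Arith Add (scalar ''t'') (entry ''a'' ''k'') (scalar ''t''),
         clip_prog (scalar ''t'') ''k'',
         Arith Mul (scalar ''t'') (scalar ''t'') (entry ''b'' ''k''),
         Arith Add (scalar g) (scalar g) (scalar ''t'')]),
      Arith Mul (scalar g) (scalar ''lam'') (scalar g),
      Arith Sub (scalar g) (scalar ''sq'') (scalar g)]"

text \<open>The values of an affine function at the ends have a negative product iff its zero is
  strictly inside; in that branch the divisor is nonzero.\<close>

definition bracket_prog :: prog where
  "bracket_prog = block
     [Lit (scalar ''lo'') 0, Lit (scalar ''hi'') 1,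
      For ''h'' (Var ''d'') (block
        [Arith Mul (scalar ''p'') (scalar ''lo'') (entry ''b'' ''h''),
         Arith Add (scalar ''p'') (entry ''a'' ''h'') (scalar ''p''),
         Arith Mul (scalar ''r'') (scalar ''hi'') (entry ''b'' ''h''),
         Arith Add (scalar ''r'') (entry ''a'' ''h'') (scalar ''r''),
         Arith Mul (scalar ''p'') (scalar ''p'') (scalar ''r''),
         IfLe (scalar ''zero'') (scalar ''p'') Skip (block
           [Arith Sub (scalar ''m'') (scalar ''zero'') (entry ''a'' ''h''),
            Arith Div (scalar ''m'') (scalar ''m'') (entry ''b'' ''h''),
            slope_prog ''m'' ''g'',
            IfLe (scalar ''zero'') (scalar ''g'')
              (Copy (scalar ''lo'') (scalar ''m'')) (Copy (scalar ''hi'') (scalar ''m''))])])]"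

text \<open>The secant step is exact because the slope is affine on the final bracket. In the last
  branch the divisor \<open>g - gh\<close> is positive.\<close>

definition interpolate_prog :: prog where
  "interpolate_prog = block
     [slope_prog ''lo'' ''g'', slope_prog ''hi'' ''gh'',
      IfLe (scalar ''g'') (scalar ''zero'') (Copy (scalar ''eta'') (scalar ''lo''))
        (IfLe (scalar ''zero'') (scalar ''gh'') (Copy (scalar ''eta'') (scalar ''hi''))
          (block
            [Arith Sub (scalar ''t'') (scalar ''g'') (scalar ''gh''),
             Arith Sub (scalar ''r'') (scalar ''hi'') (scalar ''lo''),
             Arith Mul (scalar ''r'') (scalar ''r'') (scalar ''g''),
             Arith Div (scalar ''r'') (scalar ''r'') (scalar ''t''),
             Arith Add (scalar ''eta'') (scalar ''lo'') (scalar ''r'')]))]"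

definition update_prog :: prog where
  "update_prog = For ''i'' (Var ''n'') (block
     [Arith Mul (scalar ''t'') (scalar ''eta'') (entry ''q'' ''i''),
      Arith Add (entry ''alpha'' ''i'') (entry ''alpha'' ''i'') (scalar ''t'')])"

definition fw_prog :: prog where
  "fw_prog = block [count_prog, preproj_prog ''alpha'' ''a'', vertex_prog, preproj_prog ''q'' ''b'',
     bracket_prog, interpolate_prog, update_prog]"

lemmas prog_defs = count_prog_def preproj_prog_def clip_prog_def vertex_prog_def slope_prog_def
  bracket_prog_def interpolate_prog_def update_prog_def

lemma writes_simps [simp]:
  "writes count_prog = {''zero'', ''one'', ''nr'', ''c''}"
  "writes (preproj_prog src dst) = {dst, ''t''}"
  "writes (clip_prog l v) = {loc_array l}"
  "writes vertex_prog = {''sq'', ''t'', ''r'', ''u'', ''q''}"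
  "writes (slope_prog e g) = {g, ''t''}"
  "writes bracket_prog = {''lo'', ''hi'', ''p'', ''r'', ''m'', ''g'', ''t''}"
  "writes interpolate_prog = {''g'', ''gh'', ''eta'', ''t'', ''r''}"
  "writes update_prog = {''t'', ''alpha''}"
  by (auto simp: prog_defs)

lemma loop_vars_simps [simp]:
  "loop_vars count_prog = {''i''}"
  "loop_vars (preproj_prog src dst) = {''h'', ''i''}"
  "loop_vars (clip_prog l v) = {}"
  "loop_vars vertex_prog = {''i'', ''h''}"
  "loop_vars (slope_prog e g) = {''k''}"
  "loop_vars bracket_prog = {''h'', ''k''}"
  "loop_vars interpolate_prog = {''k''}"
  "loop_vars update_prog = {''i''}"
  by (auto simp: prog_defs)

lemma fw_prog_bound: "bound_vars fw_prog \<inter> loop_vars fw_prog = {}"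
  by (simp add: fw_prog_def prog_defs)

subsection \<open>Bracketing a zero of the slope\<close>

text \<open>The derivative at \<open>e\<close> of the dual along a segment: \<open>a\<close> and
  \<open>b\<close> are \<open>preproj\<close> of its start and its direction, \<open>c\<close> is
  the mean entry of the direction.\<close>

definition line_slope ::
  "nat set \<Rightarrow> nat \<Rightarrow> (nat \<Rightarrow> real) \<Rightarrow> (nat \<Rightarrow> real) \<Rightarrow> real \<Rightarrow> real \<Rightarrow> real \<Rightarrow> real" where
  "line_slope I d a b lam c e = c - lam * (\<Sum>h<d. clip I h (a h + e * b h) * b h)"

text \<open>The last conjunct says that no breakpoint of a coordinate \<open>h < j\<close> lies strictly inside the bracket.\<close>

definition bracket ::
  "(real \<Rightarrow> real) \<Rightarrow> nat \<Rightarrow> (nat \<Rightarrow> real) \<Rightarrow> (nat \<Rightarrow> real) \<Rightarrow> real \<Rightarrow> real \<Rightarrow> bool" where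
  "bracket G j a b lo hi \<longleftrightarrow> 0 \<le> lo \<and> lo \<le> hi \<and> hi \<le> 1 \<and> (lo = 0 \<or> 0 \<le> G lo) \<and> (hi = 1 \<or> G hi \<le> 0) \<and>
     (\<forall>h<j. 0 \<le> (a h + lo * b h) * (a h + hi * b h))"

text \<open>The value at \<open>m\<close> lies between those at \<open>l\<close> and
  \<open>r\<close>. Thus a bracket can shrink without spoiling the coordinates already
  treated.\<close>

lemma affine_same_sign:
  fixes a b :: real
  assumes "0 \<le> (a + l * b) * (a + r * b)" "l \<le> m" "m \<le> r"
  shows "0 \<le> (a + l * b) * (a + m * b)" "0 \<le> (a + m * b) * (a + r * b)"
proof -
  have "a + l * b \<le> a + m * b \<and> a + m * b \<le> a + r * b \<or> a + r * b \<le> a + m * b \<and> a + m * b \<le> a + l * b"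
    using assms(2,3) by (cases "0 \<le> b") (auto intro: mult_right_mono mult_right_mono_neg)
  then show "0 \<le> (a + l * b) * (a + m * b)" "0 \<le> (a + m * b) * (a + r * b)"
    using assms(1) by (auto simp: zero_le_mult_iff)
qed

text \<open>At the new end coordinate \<open>j\<close> vanishes, which settles its sign condition;
  the sign of \<open>G\<close> there tells which end to replace.\<close>

lemma bracket_shrink:
  assumes br: "bracket G j a b lo hi" and neg: "(a j + lo * b j) * (a j + hi * b j) < 0"
  shows "b j \<noteq> 0" "0 \<le> G (- a j / b j) \<Longrightarrow> bracket G (Suc j) a b (- a j / b j) hi"
    and "G (- a j / b j) \<le> 0 \<Longrightarrow> bracket G (Suc j) a b lo (- a j / b j)"
proof -
  show b: "b j \<noteq> 0" using neg by (auto simp: mult_less_0_iff)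
  define m where "m = - a j / b j"
  have 0: "a j + m * b j = 0" using b by (simp add: m_def)
  have "a j = - (m * b j)" using 0 by linarith
  \<comment> \<open>Replacing \<open>a j\<close> by \<open>- (m * b j)\<close> factors the product,
    which places the breakpoint \<open>m\<close> between the ends.\<close>
  then have "(lo - m) * (hi - m) * (b j)\<^sup>2 < 0" using neg by (simp add: power2_eq_square algebra_simps)
  then have "(lo - m) * (hi - m) < 0" by (auto simp: mult_less_0_iff)
  then have m: "lo \<le> m" "m \<le> hi" using br by (auto simp: bracket_def mult_less_0_iff)
  show "bracket G (Suc j) a b m hi" if "0 \<le> G m"
    using br m 0 that affine_same_sign[OF _ m]
    by (auto simp: bracket_def less_Suc_eq)
  show "bracket G (Suc j) a b lo m" if "G m \<le> 0"
    using br m 0 that affine_same_sign[OF _ m]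
    by (auto simp: bracket_def less_Suc_eq)
qed

text \<open>No coordinate changes sign inside the bracket, so each \<open>clip\<close> acts there as
  the identity or as zero, and \<open>G\<close> is affine.\<close>

lemma line_slope_interpolate:
  assumes "bracket G d a b lo hi" "G = line_slope I d a b lam c" "0 \<le> t" "t \<le> 1"
  shows "G (lo + t * (hi - lo)) = G lo + t * (G hi - G lo)"
proof -
  have clip: "clip I h (a h + (lo + t * (hi - lo)) * b h) =
      clip I h (a h + lo * b h) + t * (clip I h (a h + hi * b h) - clip I h (a h + lo * b h))"
    if h: "h < d" for h
  proof -
    define p q where "p = a h + lo * b h" and "q = a h + hi * b h"
    have "0 \<le> p * q" using assms(1) h by (auto simp: bracket_def p_def q_def)
    then consider "0 \<le> p" "0 \<le> q" | "p \<le> 0" "q \<le> 0" by (auto simp: zero_le_mult_iff)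
    then have "clip I h ((1 - t) * p + t * q) = (1 - t) * clip I h p + t * clip I h q"
    proof cases
      case 1
      then have "0 \<le> (1 - t) * p + t * q" using assms(3,4) by simp
      with 1 show ?thesis by (simp add: clip_def)
    next
      case 2
      then have "(1 - t) * p + t * q \<le> 0"
        using assms(3,4) by (simp add: add_nonpos_nonpos mult_nonneg_nonpos)
      with 2 show ?thesis by (simp add: clip_def max_def)
    qed
    also have "\<dots> = clip I h p + t * (clip I h q - clip I h p)" by (simp add: algebra_simps)
    also have "(1 - t) * p + t * q = a h + (lo + t * (hi - lo)) * b h"
      by (simp add: p_def q_def algebra_simps)
    finally show ?thesis unfolding p_def q_def .
  qed
  have "(\<Sum>h<d. clip I h (a h + (lo + t * (hi - lo)) * b h) * b h) =
      (\<Sum>h<d. (clip I h (a h + lo * b h) +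
        t * (clip I h (a h + hi * b h) - clip I h (a h + lo * b h))) * b h)"
    by (intro sum.cong refl) (simp only: clip lessThan_iff)
  also have "\<dots> =
      (\<Sum>h<d. clip I h (a h + lo * b h) * b h) + t * ((\<Sum>h<d. clip I h (a h + hi * b h) * b h) -
        (\<Sum>h<d. clip I h (a h + lo * b h) * b h))"
    by (simp add: sum_subtractf sum.distrib sum_distrib_left algebra_simps)
  finally have sum_eq: "(\<Sum>h<d. clip I h (a h + (lo + t * (hi - lo)) * b h) * b h) = \<dots>" .
  show ?thesis unfolding assms(2) line_slope_def sum_eq by (simp add: algebra_simps)
qed

text \<open>The first-order condition for a maximizer over \<open>[0, 1]\<close> of a concave function with derivative \<open>G\<close>.\<close>

definition stationary01 :: "(real \<Rightarrow> real) \<Rightarrow> real \<Rightarrow> bool" where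
  "stationary01 G e \<longleftrightarrow> e \<in> {0..1} \<and> (\<forall>e'\<in>{0..1}. (e' - e) * G e \<le> 0)"

text \<open>If \<open>G lo \<le> 0\<close>, then \<open>lo = 0\<close> or the bracket forces
  \<open>G lo = 0\<close>; the other end is symmetric. Otherwise the secant point is a zero of the
  affine \<open>G\<close>.\<close>

lemma bracket_stationary:
  assumes br: "bracket G d a b lo hi" and G: "G = line_slope I d a b lam c"
  shows "G lo \<le> 0 \<Longrightarrow> stationary01 G lo"
    and "0 \<le> G hi \<Longrightarrow> stationary01 G hi"
    and "0 < G lo \<Longrightarrow> G hi < 0 \<Longrightarrow> stationary01 G (lo + (hi - lo) * G lo / (G lo - G hi))"
proof -
  show "stationary01 G lo" if "G lo \<le> 0"
    using br that by (auto simp: bracket_def stationary01_def mult_nonneg_nonpos)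
  show "stationary01 G hi" if "0 \<le> G hi"
    using br that by (auto simp: bracket_def stationary01_def mult_nonpos_nonneg)
  show "stationary01 G (lo + (hi - lo) * G lo / (G lo - G hi))" if pos: "0 < G lo" "G hi < 0"
  proof -
    define t where "t = G lo / (G lo - G hi)"
    have t: "0 \<le> t" "t \<le> 1" using pos by (auto simp: t_def)
    have eq: "lo + (hi - lo) * G lo / (G lo - G hi) = lo + t * (hi - lo)" by (simp add: t_def)
    have "t * (G lo - G hi) = G lo" using pos by (simp add: t_def)
    then have "G (lo + t * (hi - lo)) = 0"
      using line_slope_interpolate[OF br G t] by (simp add: algebra_simps)
    moreover have "lo \<le> hi" using br by (simp add: bracket_def)
    then have "0 \<le> t * (hi - lo)" "t * (hi - lo) \<le> 1 * (hi - lo)"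
      using t by (intro mult_nonneg_nonneg mult_right_mono; simp)+
    ultimately show ?thesis using br unfolding eq by (simp add: stationary01_def bracket_def)
  qed
qed

subsection \<open>Correctness of the phases\<close>

lemma wp_count_prog:
  "wp count_prog (\<lambda>s'. mem s' ''zero'' 0 0 = 0 \<and> mem s' ''one'' 0 0 = 1 \<and>
     mem s' ''nr'' 0 0 = real (idx s ''n'') \<and>
     mem s' ''c'' 0 0 = mem s ''lam'' 0 0 * real (idx s ''n'')) s"
  unfolding count_prog_def block.simps wp_simps
  by (rule wp_For[where Inv = "\<lambda>k s'. mem s' ''nr'' 0 0 = real k"]) (simp_all add: frame_def)

lemma wp_preproj_prog:
  assumes "src \<notin> {dst, ''t''}" "dst \<notin> {''t'', ''x'', ''y'', ''c''}" "mem s ''c'' 0 0 \<noteq> 0"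
  shows "wp (preproj_prog src dst) (\<lambda>s'. \<forall>h<idx s ''d''. mem s' dst h 0 =
     (\<Sum>i<idx s ''n''. mem s ''y'' i 0 * mem s ''x'' i h * mem s src i 0) / mem s ''c'' 0 0) s"
  unfolding preproj_prog_def
proof (rule wp_For[where Inv = "\<lambda>j s'. \<forall>h<j. mem s' dst h 0 =
     (\<Sum>i<idx s ''n''. mem s ''y'' i 0 * mem s ''x'' i h * mem s src i 0) / mem s ''c'' 0 0"],
    goal_cases)
  case (2 j s1)
  show ?case
    unfolding block.simps wp_simps
    \<comment> \<open>Frames work by whole arrays, so the invariant itself must carry the earlier
      entries of \<open>dst\<close>.\<close>
    by (rule wp_For[where Inv = "\<lambda>k s'. mem s' dst j 0 =
         (\<Sum>i<k. mem s ''y'' i 0 * mem s ''x'' i j * mem s src i 0) \<and>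
         (\<forall>h<j. mem s' dst h 0 = mem s1 dst h 0)"])
      (use 2 assms in \<open>auto simp: frame_def less_Suc_eq\<close>)
qed auto

lemma wp_vertex_prog:
  assumes "mem s ''zero'' 0 0 = 0" "mem s ''one'' 0 0 = 1" "mem s ''nr'' 0 0 \<noteq> 0"
    and "\<And>h. h < idx s ''d'' \<Longrightarrow> mem s ''I'' h 0 = (if h \<in> I then 1 else 0)"
    and u: "u = (\<lambda>i. if mem s ''y'' i 0 *
      (\<Sum>h<idx s ''d''. mem s ''x'' i h * clip I h (mem s ''a'' h 0)) \<le> 1 then 1 else 0)"
  shows "wp vertex_prog (\<lambda>s'. (\<forall>i<idx s ''n''. mem s' ''u'' i 0 = u i) \<and>
     (\<forall>i<idx s ''n''. mem s' ''q'' i 0 = u i - mem s ''alpha'' i 0) \<and>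
     mem s' ''sq'' 0 0 = (\<Sum>i<idx s ''n''. u i - mem s ''alpha'' i 0) / mem s ''nr'' 0 0) s"
  unfolding vertex_prog_def block.simps wp_simps
proof (rule wp_For[where Inv = "\<lambda>j s'. (\<forall>i<j. mem s' ''u'' i 0 = u i) \<and>
     (\<forall>i<j. mem s' ''q'' i 0 = u i - mem s ''alpha'' i 0) \<and>
     mem s' ''sq'' 0 0 = (\<Sum>i<j. u i - mem s ''alpha'' i 0)"], goal_cases)
  case (2 j s1)
  note m1 = frame_mem[OF 2(2)] frame_idx[OF 2(2)] and inv = 2(3)
  show ?case
    unfolding block.simps wp_simps
  proof (rule wp_For[where Inv = "\<lambda>k s'. mem s' ''t'' 0 0 =
       (\<Sum>h<k. mem s ''x'' j h * clip I h (mem s ''a'' h 0))"], goal_cases)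
    case (2 k s2)
    note m2 = frame_mem[OF 2(2)] frame_idx[OF 2(2)]
    have "k < idx s ''d''" using 2(1) by (simp add: m1)
    then show ?case
      using 2(3) by (simp add: m1 m2 assms(1,2,4) clip_prog_def clip_def max_def)
  next
    case (3 s2)
    note m2 = frame_mem[OF 3(1)] frame_idx[OF 3(1)]
    have t: "mem s2 ''t'' 0 0 = (\<Sum>h<idx s ''d''. mem s ''x'' j h * clip I h (mem s ''a'' h 0))"
      using 3(2) by (simp add: m1)
    show ?case
    proof (cases "mem s ''y'' j 0 * mem s2 ''t'' 0 0 \<le> 1")
      case True
      then have "u j = 1" by (simp add: u t)
      then show ?thesis using inv True by (simp add: m1 m2 assms(2) All_less_Suc nat_neq_iff)
    next
      case False
      then have "u j = 0" by (simp add: u t)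
      then show ?thesis using inv False by (simp add: m1 m2 assms(2) All_less_Suc nat_neq_iff)
    qed
  qed simp
next
  case (3 s1)
  then show ?case using assms(3) by (simp add: frame_mem[OF 3(1)] frame_idx[OF 3(1)])
qed simp

text \<open>The postcondition is arbitrary because the slope is evaluated in the middle of larger
  programs, where \<open>Q\<close> stands for the remaining code.\<close>

lemma wp_slope_prog:
  assumes "e \<noteq> g" "e \<noteq> ''t''" "g \<notin> {''t'', ''a'', ''b'', ''I'', ''zero'', ''lam'', ''sq''}"
    and "mem s ''zero'' 0 0 = 0"
    and "\<And>h. h < idx s ''d'' \<Longrightarrow> mem s ''I'' h 0 = (if h \<in> I then 1 else 0)"
    and post: "\<And>s'. frame (slope_prog e g) s s' \<Longrightarrow> mem s' g 0 0 =
      line_slope I (idx s ''d'') (\<lambda>h. mem s ''a'' h 0) (\<lambda>h. mem s ''b'' h 0)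
        (mem s ''lam'' 0 0) (mem s ''sq'' 0 0) (mem s e 0 0) \<Longrightarrow> Q s'"
  shows "wp (slope_prog e g) Q s"
proof (rule wp_mono[OF wp_frame])
  have ne: "e \<noteq> g" "e \<noteq> ''t''" "''t'' \<noteq> g" "''a'' \<noteq> g" "''b'' \<noteq> g" "''I'' \<noteq> g" "''zero'' \<noteq> g"
    "''lam'' \<noteq> g" "''sq'' \<noteq> g" "g \<noteq> ''t''" "g \<noteq> ''a''" "g \<noteq> ''b''" "g \<noteq> ''I''" "g \<noteq> ''zero''"
    using assms(1-3) by auto
  show "wp (slope_prog e g) (\<lambda>s'. mem s' g 0 0 =
      line_slope I (idx s ''d'') (\<lambda>h. mem s ''a'' h 0) (\<lambda>h. mem s ''b'' h 0)
        (mem s ''lam'' 0 0) (mem s ''sq'' 0 0) (mem s e 0 0)) s"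
    unfolding slope_prog_def block.simps wp_simps
  proof (rule wp_For[where Inv = "\<lambda>k s'. mem s' g 0 0 =
       (\<Sum>h<k. clip I h (mem s ''a'' h 0 + mem s e 0 0 * mem s ''b'' h 0) * mem s ''b'' h 0)"],
       goal_cases)
    case (2 k s1)
    note m1 = frame_mem[OF 2(2)] frame_idx[OF 2(2)]
    have "k < idx s ''d''" using 2(1) by simp
    then show ?case
      using 2(3) by (simp add: m1 ne assms(4,5) clip_prog_def clip_def max_def)
  next
    case (3 s1)
    note m1 = frame_mem[OF 3(1)] frame_idx[OF 3(1)]
    show ?case
      using 3(2) by (simp add: m1 ne line_slope_def)
  qed simp
qed (use post in auto)

lemma wp_bracket_prog:
  assumes "mem s ''zero'' 0 0 = 0"
    and "\<And>h. h < idx s ''d'' \<Longrightarrow> mem s ''I'' h 0 = (if h \<in> I then 1 else 0)"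
    and a: "a = (\<lambda>h. mem s ''a'' h 0)" and b: "b = (\<lambda>h. mem s ''b'' h 0)"
    and G: "G = line_slope I (idx s ''d'') a b (mem s ''lam'' 0 0) (mem s ''sq'' 0 0)"
  shows "wp bracket_prog
     (\<lambda>s'. bracket G (idx s ''d'') a b (mem s' ''lo'' 0 0) (mem s' ''hi'' 0 0)) s"
  unfolding bracket_prog_def block.simps wp_simps
proof (rule wp_For[where Inv =
      "\<lambda>j s'. bracket G j a b (mem s' ''lo'' 0 0) (mem s' ''hi'' 0 0)"],
    goal_cases)
  case (2 j s1)
  define lo hi where "lo = mem s1 ''lo'' 0 0" and "hi = mem s1 ''hi'' 0 0"
  have br: "bracket G j a b lo hi" using 2(3) by (simp add: lo_def hi_def)
  note m = frame_mem[OF 2(2)] frame_idx[OF 2(2)]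
  have j: "j < idx s ''d''" using 2(1) by simp
  show ?case
  proof (cases "0 \<le> (a j + lo * b j) * (a j + hi * b j)")
    case True
    then have "bracket G (Suc j) a b lo hi" using br by (auto simp: bracket_def less_Suc_eq)
    moreover have "0 \<le> (mem s ''a'' j 0 + mem s1 ''lo'' 0 0 * mem s ''b'' j 0) *
        (mem s ''a'' j 0 + mem s1 ''hi'' 0 0 * mem s ''b'' j 0)"
      using True by (simp add: a b lo_def hi_def)
    ultimately show ?thesis by (simp add: m assms(1) lo_def hi_def)
  next
    case False
    then have neg: "(a j + lo * b j) * (a j + hi * b j) < 0" by simp
    note br' = bracket_shrink[OF br neg]
    have nonneg: "\<not> 0 \<le> (mem s ''a'' j 0 + mem s1 ''lo'' 0 0 * mem s ''b'' j 0) *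
        (mem s ''a'' j 0 + mem s1 ''hi'' 0 0 * mem s ''b'' j 0)"
      using False by (simp add: a b lo_def hi_def)
    show ?thesis
      apply (simp add: m assms(1) nonneg)
      \<comment> \<open>The left conjunct is the nonzero divisor demanded by
        \<open>Div\<close>.\<close>
      apply (rule conjI)
      subgoal using br'(1) by (simp add: b)
      apply (rule wp_slope_prog[where I = I])
      subgoal by simp
      subgoal by simp
      subgoal by simp
      subgoal by (simp add: m assms(1))
      subgoal by (simp add: m assms(2))
      subgoal premises prems for s2
      proof -
        note f = frame_mem[OF prems(1)]
        define r where "r = - a j / b j"
        have "mem s2 ''g'' 0 0 = G r"
          using prems(2) by (simp add: m G a b r_def)
        moreover have "mem s2 ''m'' 0 0 = r" "mem s2 ''zero'' 0 0 = 0"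
          "mem s2 ''lo'' 0 0 = lo" "mem s2 ''hi'' 0 0 = hi"
          by (simp_all add: f m assms(1) lo_def hi_def r_def a b)
        ultimately show ?thesis using br'(2,3)[folded r_def] by simp
      qed
      done
  qed
next
  case 1
  then show ?case by (simp add: bracket_def)
next
  case (3 s1)
  then show ?case by simp
qed

lemma wp_interpolate_prog:
  assumes "mem s ''zero'' 0 0 = 0"
    and "\<And>h. h < idx s ''d'' \<Longrightarrow> mem s ''I'' h 0 = (if h \<in> I then 1 else 0)"
    and a: "a = (\<lambda>h. mem s ''a'' h 0)" and b: "b = (\<lambda>h. mem s ''b'' h 0)"
    and G: "G = line_slope I (idx s ''d'') a b (mem s ''lam'' 0 0) (mem s ''sq'' 0 0)"
    and br: "bracket G (idx s ''d'') a b (mem s ''lo'' 0 0) (mem s ''hi'' 0 0)"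
  shows "wp interpolate_prog (\<lambda>s'. stationary01 G (mem s' ''eta'' 0 0)) s"
  unfolding interpolate_prog_def block.simps wp_simps
proof (rule wp_slope_prog[where I = I], goal_cases)
  \<comment> \<open>Premise 6 of \<open>wp_slope_prog\<close> is the continuation after the
    evaluation at \<open>lo\<close>.\<close>
  case (6 s1)
  note m1 = frame_mem[OF 6(1)] frame_idx[OF 6(1)] and g = 6(2)
  show ?case
  proof (rule wp_slope_prog[where I = I], goal_cases)
    case (6 s2)
    note m2 = frame_mem[OF 6(1)]
    define lo hi where "lo = mem s ''lo'' 0 0" and "hi = mem s ''hi'' 0 0"
    note st = bracket_stationary[OF br G, folded lo_def hi_def]
    have s2: "mem s2 ''g'' 0 0 = G lo" "mem s2 ''gh'' 0 0 = G hi"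
      using 6(2) g by (simp_all add: m1 m2 G a b lo_def hi_def)
    have s2': "mem s2 ''lo'' 0 0 = lo" "mem s2 ''hi'' 0 0 = hi" "mem s2 ''zero'' 0 0 = 0"
      by (simp_all add: m1 m2 lo_def hi_def assms(1))
    consider "G lo \<le> 0" | "0 < G lo" "0 \<le> G hi" | "0 < G lo" "G hi < 0" by linarith
    then show ?case
    proof cases
      case 1
      then show ?thesis using st(1) by (simp add: s2 s2')
    next
      case 2
      then show ?thesis using st(2) by (simp add: s2 s2')
    next
      case 3
      then show ?thesis using st(3) by (simp add: s2 s2')
    qed
  qed (simp_all add: m1 assms(1,2))
qed (simp_all add: assms(1,2))

lemma wp_update_prog:
  "wp update_prog (\<lambda>s'. \<forall>i<idx s ''n''. mem s' ''alpha'' i 0 =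
     mem s ''alpha'' i 0 + mem s ''eta'' 0 0 * mem s ''q'' i 0) s"
  unfolding update_prog_def
\<comment> \<open>The update is in place, so the invariant also records that entries from
  \<open>j\<close> on keep their old values.\<close>
proof (rule wp_For[where Inv = "\<lambda>j s'. \<forall>i. mem s' ''alpha'' i 0 =
     mem s ''alpha'' i 0 + (if i < j then mem s ''eta'' 0 0 * mem s ''q'' i 0 else 0)"], goal_cases)
  case (2 j s1)
  then show ?case by (simp add: frame_mem[OF 2(2)] less_Suc_eq)
qed auto

subsection \<open>Correctness and cost of the whole step\<close>

lemma wpE:
  assumes "wp p Q s"
  obtains s' where "run p s = Some s'" "frame p s s'" "Q s'"
  using assms run_frame by (auto simp: wp_def)

text \<open>The quadratic term counts \<open>d\<close> slope evaluations at 6 operations per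
  coordinate. The mixed term has 3 per entry for each of the two \<open>preproj_prog\<close> calls
  and 4 for \<open>vertex_prog\<close>.\<close>

lemma fw_prog_cost:
  "cost fw_prog s = 13 + 25 * idx s ''d'' + 7 * idx s ''n'' + 6 * (idx s ''d'' * idx s ''d'') +
     10 * (idx s ''d'' * idx s ''n'')"
  by (simp add: fw_prog_def prog_defs algebra_simps)
context svm_instance
begin

lemma run_fw_prog:
  assumes enc: "encodes n d lam x y I \<alpha> s" and \<alpha>: "\<alpha> \<in> box01 n"
  obtains s' \<alpha>' where "run fw_prog s = Some s'" "encodes n d lam x y I \<alpha>' s'"
    "fw_step n d lam x y I \<alpha> (vec n (\<lambda>i. mem s' ''u'' i 0)) (mem s' ''eta'' 0 0) \<alpha>'"
proof -
  have s: "idx s ''n'' = n" "idx s ''d'' = d" "mem s ''lam'' 0 0 = lam"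
    "\<And>i h. i < n \<Longrightarrow> h < d \<Longrightarrow> mem s ''x'' i h = x i $ h" "\<And>i. i < n \<Longrightarrow> mem s ''y'' i 0 = y i"
    "\<And>h. h < d \<Longrightarrow> mem s ''I'' h 0 = (if h \<in> I then 1 else 0)"
    "\<And>i. i < n \<Longrightarrow> mem s ''alpha'' i 0 = \<alpha> $ i"
    using enc by (auto simp: encodes_def)
  have \<alpha>': "\<alpha> \<in> carrier_vec n" using \<alpha> by (simp add: box01_def)
  obtain s1 where r1: "run count_prog s = Some s1" and f1: "frame count_prog s s1"
    and s1: "mem s1 ''zero'' 0 0 = 0" "mem s1 ''one'' 0 0 = 1" "mem s1 ''nr'' 0 0 = real n"
      "mem s1 ''c'' 0 0 = lam * real n"
    using wp_count_prog[of s] by (elim wpE) (auto simp: s)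
  note f1 = frame_mem[OF f1] frame_idx[OF f1]
  have c: "lam * real n \<noteq> 0" using lam_pos n_pos by simp
  obtain s2 where r2: "run (preproj_prog ''alpha'' ''a'') s1 = Some s2"
    and f2: "frame (preproj_prog ''alpha'' ''a'') s1 s2"
    and s2: "\<And>h. h < d \<Longrightarrow> mem s2 ''a'' h 0 = preproj \<alpha> h"
    by (rule wpE[OF wp_preproj_prog[of "''alpha''" "''a''" s1]])
      (use c in \<open>auto simp: f1 s s1 preproj_def\<close>)
  note f2 = frame_mem[OF f2] frame_idx[OF f2]
  define u' where "u' = (\<lambda>i. if mem s2 ''y'' i 0 *
      (\<Sum>h<idx s2 ''d''. mem s2 ''x'' i h * clip I h (mem s2 ''a'' h 0)) \<le> 1 then 1 else (0::real))"
  obtain s3 where r3: "run vertex_prog s2 = Some s3" and f3: "frame vertex_prog s2 s3"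
    and s3: "\<And>i. i < n \<Longrightarrow> mem s3 ''u'' i 0 = u' i"
      "\<And>i. i < n \<Longrightarrow> mem s3 ''q'' i 0 = u' i - \<alpha> $ i"
      "mem s3 ''sq'' 0 0 = (\<Sum>i<n. u' i - \<alpha> $ i) / real n"
    by (rule wpE[OF wp_vertex_prog[of s2 I, OF _ _ _ _ u'_def]])
      (use n_pos in \<open>auto simp: f1 f2 s s1\<close>)
  note f3 = frame_mem[OF f3] frame_idx[OF f3]
  have u': "u' i = (if y i * (\<Sum>h<d. x i $ h * clip I h (preproj \<alpha> h)) \<le> 1 then 1 else 0)"
    if "i < n" for i
    using that by (simp add: u'_def f1 f2 s s2)
  define u where "u = vec n u'"
  have u: "u \<in> carrier_vec n" by (simp add: u_def)
  have q: "mem s3 ''q'' i 0 = (u - \<alpha>) $ i" if "i < n" for i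
    using that \<alpha>' by (simp add: s3(2) u_def)
  have sq: "mem s3 ''sq'' 0 0 = (\<Sum>i<n. (u - \<alpha>) $ i) / real n"
    using \<alpha>' by (simp add: s3(3) u_def)
  have qc: "u - \<alpha> \<in> carrier_vec n" using \<alpha>' u by simp
  obtain s4 where r4: "run (preproj_prog ''q'' ''b'') s3 = Some s4"
    and f4: "frame (preproj_prog ''q'' ''b'') s3 s4"
    and s4: "\<And>h. h < d \<Longrightarrow> mem s4 ''b'' h 0 = preproj (u - \<alpha>) h"
    by (rule wpE[OF wp_preproj_prog[of "''q''" "''b''" s3]])
      (use c in \<open>auto simp: f1 f2 f3 s s1 q preproj_def\<close>)
  note f4 = frame_mem[OF f4] frame_idx[OF f4]
  define G where "G = line_slope I d (\<lambda>h. mem s4 ''a'' h 0) (\<lambda>h. mem s4 ''b'' h 0) lam (mem s4 ''sq'' 0 0)"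
  \<comment> \<open>By linearity of \<open>preproj\<close>, the stored arrays give the slope at
    every point of the segment.\<close>
  have G: "G e = slope (\<alpha> + e \<cdot>\<^sub>v (u - \<alpha>)) (u - \<alpha>)" for e
    by (simp add: G_def line_slope_def slope_def f3 f4 s2 s4 sq preproj_add[OF \<alpha>' qc])
  obtain s5 where r5: "run bracket_prog s4 = Some s5" and f5: "frame bracket_prog s4 s5"
    and s5: "bracket G d (\<lambda>h. mem s4 ''a'' h 0) (\<lambda>h. mem s4 ''b'' h 0) (mem s5 ''lo'' 0 0) (mem s5 ''hi'' 0 0)"
    by (rule wpE[OF wp_bracket_prog[of s4 I, OF _ _ refl refl refl]])
      (use that in \<open>auto simp: f1 f2 f3 f4 s s1 G_def\<close>)
  note f5 = frame_mem[OF f5] frame_idx[OF f5]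
  obtain s6 where r6: "run interpolate_prog s5 = Some s6" and f6: "frame interpolate_prog s5 s6"
    and s6: "stationary01 G (mem s6 ''eta'' 0 0)"
    by (rule wpE[OF wp_interpolate_prog[of s5 I, OF _ _ refl refl refl]])
      (use s5 in \<open>auto simp: f1 f2 f3 f4 f5 s s1 G_def\<close>)
  note f6 = frame_mem[OF f6] frame_idx[OF f6]
  obtain s7 where r7: "run update_prog s6 = Some s7" and f7: "frame update_prog s6 s7"
    and s7: "\<And>i. i < n \<Longrightarrow> mem s7 ''alpha'' i 0 = \<alpha> $ i + mem s6 ''eta'' 0 0 * (u - \<alpha>) $ i"
    by (rule wpE[OF wp_update_prog[of s6]])
      (use that in \<open>auto simp: f1 f2 f3 f4 f5 f6 s q\<close>)
  note f7 = frame_mem[OF f7] frame_idx[OF f7]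
  define \<eta> where "\<eta> = mem s6 ''eta'' 0 0"
  have "run fw_prog s = Some s7"
    using r1 r2 r3 r4 r5 r6 r7 by (simp add: fw_prog_def)
  moreover have "encodes n d lam x y I (\<alpha> + \<eta> \<cdot>\<^sub>v (u - \<alpha>)) s7"
    using \<alpha>' u by (simp add: encodes_def f1 f2 f3 f4 f5 f6 f7 s s7 \<eta>_def)
  moreover have "fw_step n d lam x y I \<alpha> (vec n (\<lambda>i. mem s7 ''u'' i 0)) (mem s7 ''eta'' 0 0)
      (\<alpha> + \<eta> \<cdot>\<^sub>v (u - \<alpha>))"
  proof -
    have "vec n (\<lambda>i. mem s7 ''u'' i 0) = u" "mem s7 ''eta'' 0 0 = \<eta>"
      using s3(1) by (auto simp: u_def \<eta>_def f4 f5 f6 f7)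
    moreover have "is_arg_max (\<lambda>v. grad n D \<alpha> \<bullet> v) (\<lambda>v. v \<in> box01 n) u"
      unfolding is_arg_max_linorder
    proof (intro conjI allI impI)
      show "u \<in> box01 n" by (simp add: box01_def u_def u')
      fix v assume v: "v \<in> box01 n"
      \<comment> \<open>The objective separates over coordinates; below, \<open>c\<close> is
        \<open>n\<close> times the coefficient whose sign decides \<open>u $ i\<close>.\<close>
      have "dual_grad \<alpha> i * v $ i \<le> dual_grad \<alpha> i * u $ i" if i: "i < n" for i
      proof -
        have "0 \<le> v $ i" "v $ i \<le> 1" using v i by (auto simp: box01_def)
        moreover define c where "c = 1 - y i * (\<Sum>h<d. x i $ h * clip I h (preproj \<alpha> h))"
        moreover have "u $ i = (if 0 \<le> c then 1 else 0)" using i by (simp add: u_def u' c_def)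
        ultimately have "c * v $ i \<le> c * u $ i" by (simp add: mult_left_le mult_nonpos_nonneg)
        then show ?thesis by (simp add: dual_grad_def c_def[symmetric] divide_right_mono)
      qed
      then have "slope \<alpha> v \<le> slope \<alpha> u"
        unfolding slope_eq by (intro sum_mono) simp
      then show "grad n D \<alpha> \<bullet> v \<le> grad n D \<alpha> \<bullet> u"
        using v u \<alpha>' by (simp add: grad_scalar_prod box01_def)
    qed
    moreover have "is_arg_max (\<lambda>e. D (\<alpha> + e \<cdot>\<^sub>v (u - \<alpha>))) (\<lambda>e. e \<in> {0..1}) \<eta>"
      unfolding is_arg_max_linorder
    proof (intro conjI allI impI)
      show "\<eta> \<in> {0..1}" using s6 by (simp add: \<eta>_def stationary01_def)
      fix e :: real assume "e \<in> {0..1}"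
      then have "(e - \<eta>) * slope (\<alpha> + \<eta> \<cdot>\<^sub>v (u - \<alpha>)) (u - \<alpha>) \<le> 0"
        using s6 by (simp add: \<eta>_def stationary01_def G)
      \<comment> \<open>Recentred at the new iterate, concavity with the signed step
        \<open>e - \<eta>\<close> turns stationarity into maximality on
        \<open>[0, 1]\<close>.\<close>
      moreover have "\<alpha> + e \<cdot>\<^sub>v (u - \<alpha>) = \<alpha> + \<eta> \<cdot>\<^sub>v (u - \<alpha>) + (e - \<eta>) \<cdot>\<^sub>v (u - \<alpha>)"
        using u \<alpha>' by (intro eq_vecI) (auto simp: algebra_simps)
      moreover have "\<alpha> + \<eta> \<cdot>\<^sub>v (u - \<alpha>) \<in> carrier_vec n" using u \<alpha>' by simp
      ultimately show "D (\<alpha> + e \<cdot>\<^sub>v (u - \<alpha>)) \<le> D (\<alpha> + \<eta> \<cdot>\<^sub>v (u - \<alpha>))"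
        using svm_dual_le[OF _ qc, of "\<alpha> + \<eta> \<cdot>\<^sub>v (u - \<alpha>)" "e - \<eta>"] by simp
    qed
    ultimately show ?thesis by (simp add: fw_step_def)
  qed
  ultimately show thesis by (rule that)
qed

end

text \<open>Since \<open>n\<close> and \<open>d\<close> are at least 1, all terms but the quadratic
  one sum to at most \<open>(13 + 25 + 7 + 10) * (n * d)\<close>; \<open>d \<le> K * n\<close>
  bounds that one by \<open>6 * K * (n * d)\<close>.\<close>

lemma performs_fw_step_fw_prog:
  assumes val: "valid_instance n d lam x y I" and d: "real d \<le> K * real n" and \<alpha>: "\<alpha> \<in> box01 n"
  shows "performs_fw_step fw_prog ((55 + 6 * K) * (real n * real d)) n d lam x y I \<alpha>"
  unfolding performs_fw_step_def
proof (intro allI impI, elim conjE)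
  fix s assume enc: "encodes n d lam x y I \<alpha> s" and ops: "ops s = 0"
  interpret svm_instance n d lam x y I using val by unfold_locales
  obtain s' \<alpha>' where r: "run fw_prog s = Some s'" and e: "encodes n d lam x y I \<alpha>' s'"
    "fw_step n d lam x y I \<alpha> (vec n (\<lambda>i. mem s' ''u'' i 0)) (mem s' ''eta'' 0 0) \<alpha>'"
    using run_fw_prog[OF enc \<alpha>] .
  have nd: "idx s ''n'' = n" "idx s ''d'' = d" using enc by (simp_all add: encodes_def)
  have "ops s' \<le> 13 + 25 * d + 7 * n + 6 * (d * d) + 10 * (d * n)"
    using run_cost[OF r fw_prog_bound] ops unfolding fw_prog_cost nd by simp
  then have "real (ops s') \<le> real (13 + 25 * d + 7 * n + 6 * (d * d) + 10 * (d * n))"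
    by (simp only: of_nat_le_iff)
  also have "\<dots> = 13 + 25 * real d + 7 * real n + 6 * (real d * real d) + 10 * (real n * real d)"
    by simp
  also have "\<dots> \<le> 13 * (real n * real d) + 25 * (real n * real d) + 7 * (real n * real d) +
      6 * (K * real n * real d) + 10 * (real n * real d)"
  proof -
    have n1: "1 \<le> real n" and d1: "1 \<le> real d" using n_pos d_pos by auto
    have "1 * real d \<le> real n * real d" "real n * 1 \<le> real n * real d"
      using n1 d1 by (intro mult_mono; simp)+
    moreover have "real d * real d \<le> K * real n * real d" using d by (intro mult_right_mono) auto
    ultimately show ?thesis using n1 by linarith
  qed
  also have "\<dots> = (55 + 6 * K) * (real n * real d)" by (simp add: algebra_simps)
  finally show "\<exists>s' \<alpha>'. run fw_prog s = Some s' \<and> real (ops s') \<le> (55 + 6 * K) * (real n * real d) \<and>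
      encodes n d lam x y I \<alpha>' s' \<and>
      fw_step n d lam x y I \<alpha> (vec n (\<lambda>i. mem s' ''u'' i 0)) (mem s' ''eta'' 0 0) \<alpha>'"
    using r e by blast
qed

theorem theorem6p1:
  shows
    "(\<exists>p. \<forall>K::real. \<exists>C::real. \<forall>n d lam x y I \<alpha>.
        valid_instance n d lam x y I \<and> real d \<le> K * real n \<and> \<alpha> \<in> box01 n \<longrightarrow>
        performs_fw_step p (C * (real n * real d)) n d lam x y I \<alpha>)
     \<and>
     (\<forall>n d lam x y I (R::real) \<alpha> u \<eta> \<alpha>star (\<epsilon>::real) (T::nat).
        valid_instance n d lam x y I \<and> (\<forall>i<n. vnorm (x i) \<le> R) \<and>
        fw_run n d lam x y I \<alpha> u \<eta> \<and>
        is_arg_max (svm_dual n d lam x y I) (\<lambda>a. a \<in> box01 n) \<alpha>star \<and>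
        0 < \<epsilon> \<and> 1 \<le> T \<and> real T \<ge> 2 * R\<^sup>2 / (lam * \<epsilon>) - 2 \<longrightarrow>
        svm_dual n d lam x y I \<alpha>star - svm_dual n d lam x y I (\<alpha> T) \<le> \<epsilon>)"
proof (intro conjI)
  show "\<exists>p. \<forall>K::real. \<exists>C::real. \<forall>n d lam x y I \<alpha>.
      valid_instance n d lam x y I \<and> real d \<le> K * real n \<and> \<alpha> \<in> box01 n \<longrightarrow>
      performs_fw_step p (C * (real n * real d)) n d lam x y I \<alpha>"
    \<comment> \<open>One program serves all \<open>K\<close>; only \<open>C = 55 + 6 * K\<close>
      varies.\<close>
    using performs_fw_step_fw_prog by blast
qed (auto simp: is_arg_max_def intro!: svm_instance.fw_run_gap svm_instance.intro)

end
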